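(* Let $\Gamma$ be a discrete amenable group. Let $X$ be a compact Hausdorff abelian group carrying a continuous $\Gamma$-action by automorphisms, and let $Y\le X$ be a $\Gamma$-invariant closed subgroup. Then $$h(X)=h(Y)+h(X/Y),$$ where $X/Y$ is the quotient group with the induced $\Gamma$-action and $h(\cdot)$ denotes the topological entropy of a continuous $\Gamma$-action.
   Context: $\mathcal F(\Gamma)$ is the set of nonempty finite subsets of $\Gamma$. For $K\in\mathcal F(\Gamma)$, $\delta>0$, $F\in\mathcal F(\Gamma)$ is $(K,\delta)$-invariant if $|\{s\in F:Ks\subseteq F\}|\ge(1-\delta)|F|$; $\lim_F\varphi(F)=c$ means: for every $\varepsilon>0$ there are $K\in\mathcal F(\Gamma)$ and $\delta>0$ with $|\varphi(F)-c|<\varepsilon$ for all $(K,\delta)$-invariant $F$. The topological entropy of a continuous action of $\Gamma$ on a compact Hausdorff space $X$ is $h(X)=\sup_{\mathcal U}\lim_F\frac{\log N(\bigvee_{s\in F}s^{-1}\mathcal U)}{|F|}\in[0,+\infty]$, where $\mathcal U$ ranges over finite open covers of $X$ and $N(\mathcal V)$ is the minimal cardinality of a subcover of $\mathcal V$. *)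

theory Defs
  imports "HOL-Analysis.Analysis" "HOL-Algebra.Coset" "HOL-Algebra.Bij"
begin

section \<open>Amenability and limits along invariant finite sets\<close>

definition fin_subsets :: "('g, 'm) monoid_scheme \<Rightarrow> 'g set set" where
  "fin_subsets \<Gamma> = {F. finite F \<and> F \<noteq> {} \<and> F \<subseteq> carrier \<Gamma>}"

text \<open>The right coset notation \<open>K #> s\<close> is the set of all \<open>k \<otimes> s\<close> with \<open>k \<in> K\<close>, for an arbitrary set \<open>K\<close>.\<close>

definition invariant_set :: "('g, 'm) monoid_scheme \<Rightarrow> 'g set \<Rightarrow> real \<Rightarrow> 'g set \<Rightarrow> bool" where
  "invariant_set \<Gamma> K \<delta> F \<longleftrightarrow>
     F \<in> fin_subsets \<Gamma> \<and>
     real (card {s \<in> F. K #>\<^bsub>\<Gamma>\<^esub> s \<subseteq> F}) \<ge> (1 - \<delta>) * real (card F)"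

text \<open>Amenability in the sense of Folner; there is no countability assumption.\<close>

definition amenable_group :: "('g, 'm) monoid_scheme \<Rightarrow> bool" where
  "amenable_group \<Gamma> \<longleftrightarrow>
     group \<Gamma> \<and> (\<forall>K \<in> fin_subsets \<Gamma>. \<forall>\<delta>>0. \<exists>F. invariant_set \<Gamma> K \<delta> F)"

definition invariant_tendsto ::
    "('g, 'm) monoid_scheme \<Rightarrow> ('g set \<Rightarrow> real) \<Rightarrow> real \<Rightarrow> bool" where
  "invariant_tendsto \<Gamma> \<phi> c \<longleftrightarrow>
     (\<forall>\<epsilon>>0. \<exists>K \<in> fin_subsets \<Gamma>. \<exists>\<delta>>0. \<forall>F. invariant_set \<Gamma> K \<delta> F \<longrightarrow> \<bar>\<phi> F - c\<bar> < \<epsilon>)"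

text \<open>
  Uniqueness of the limit is exactly what amenability provides. For the functions to which the
  limit is applied below, its existence is the Ornstein-Weiss lemma.
\<close>

definition invariant_lim :: "('g, 'm) monoid_scheme \<Rightarrow> ('g set \<Rightarrow> real) \<Rightarrow> real" where
  "invariant_lim \<Gamma> \<phi> = (THE c. invariant_tendsto \<Gamma> \<phi> c)"

lemma invariant_tendsto_unique:
  assumes "amenable_group \<Gamma>" "invariant_tendsto \<Gamma> \<phi> a" "invariant_tendsto \<Gamma> \<phi> b"
  shows "a = b"
proof (rule ccontr)
  assume "a \<noteq> b"
  define e where "e = \<bar>a - b\<bar> / 2"
  have "e > 0" using \<open>a \<noteq> b\<close> by (simp add: e_def)
  obtain K d where K: "K \<in> fin_subsets \<Gamma>" "d > 0"
    and Ka: "\<And>F. invariant_set \<Gamma> K d F \<Longrightarrow> \<bar>\<phi> F - a\<bar> < e"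
    using assms(2) \<open>e > 0\<close> unfolding invariant_tendsto_def by meson
  obtain L d' where L: "L \<in> fin_subsets \<Gamma>" "d' > 0"
    and Lb: "\<And>F. invariant_set \<Gamma> L d' F \<Longrightarrow> \<bar>\<phi> F - b\<bar> < e"
    using assms(3) \<open>e > 0\<close> unfolding invariant_tendsto_def by meson
  have "K \<union> L \<in> fin_subsets \<Gamma>" "min d d' > 0"
    using K L by (auto simp: fin_subsets_def)
  then obtain F where F: "invariant_set \<Gamma> (K \<union> L) (min d d') F"
    using assms(1) unfolding amenable_group_def by meson
  have mono: "invariant_set \<Gamma> M c F" if "M \<subseteq> K \<union> L" "min d d' \<le> c" for M c
  proof -
    have fin: "finite F" using F by (simp add: invariant_set_def fin_subsets_def)
    have "(1 - c) * real (card F) \<le> (1 - min d d') * real (card F)"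
      using that(2) by (intro mult_right_mono) auto
    also have "\<dots> \<le> real (card {s \<in> F. (K \<union> L) #>\<^bsub>\<Gamma>\<^esub> s \<subseteq> F})"
      using F by (simp add: invariant_set_def)
    also have "\<dots> \<le> real (card {s \<in> F. M #>\<^bsub>\<Gamma>\<^esub> s \<subseteq> F})"
    proof -
      have "M #>\<^bsub>\<Gamma>\<^esub> s \<subseteq> (K \<union> L) #>\<^bsub>\<Gamma>\<^esub> s" for s
        using that(1) unfolding r_coset_def by blast
      then have "{s \<in> F. (K \<union> L) #>\<^bsub>\<Gamma>\<^esub> s \<subseteq> F} \<subseteq> {s \<in> F. M #>\<^bsub>\<Gamma>\<^esub> s \<subseteq> F}"
        by blast
      then show ?thesis using fin by (intro of_nat_mono card_mono) auto
    qed
    finally show ?thesis using F by (simp add: invariant_set_def)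
  qed
  have "\<bar>\<phi> F - a\<bar> < e" "\<bar>\<phi> F - b\<bar> < e"
    using Ka[OF mono] Lb[OF mono] by auto
  then have "\<bar>a - b\<bar> < e + e" by linarith
  then show False by (simp add: e_def)
qed

section \<open>Topological entropy\<close>

definition finite_open_cover :: "'a topology \<Rightarrow> 'a set set \<Rightarrow> bool" where
  "finite_open_cover T \<U> \<longleftrightarrow> finite \<U> \<and> (\<forall>U \<in> \<U>. openin T U) \<and> \<Union>\<U> = topspace T"

definition preimage_cover :: "'a topology \<Rightarrow> ('a \<Rightarrow> 'a) \<Rightarrow> 'a set set \<Rightarrow> 'a set set" where
  "preimage_cover T f \<U> = (\<lambda>U. {x \<in> topspace T. f x \<in> U}) ` \<U>"

definition join_covers :: "'i set \<Rightarrow> ('i \<Rightarrow> 'a set set) \<Rightarrow> 'a set set" where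
  "join_covers I \<V> = {\<Inter>i\<in>I. W i | W. \<forall>i\<in>I. W i \<in> \<V> i}"

definition min_subcover_card :: "'a topology \<Rightarrow> 'a set set \<Rightarrow> nat" where
  "min_subcover_card T \<V> =
     (LEAST n. \<exists>\<W>. \<W> \<subseteq> \<V> \<and> finite \<W> \<and> \<Union>\<W> = topspace T \<and> card \<W> = n)"

definition topological_entropy ::
    "('g, 'm) monoid_scheme \<Rightarrow> 'a topology \<Rightarrow> ('g \<Rightarrow> 'a \<Rightarrow> 'a) \<Rightarrow> ereal" where
  "topological_entropy \<Gamma> T \<alpha> =
     (SUP \<U> \<in> {\<U>. finite_open_cover T \<U>}.
        ereal (invariant_lim \<Gamma> (\<lambda>F.
          ln (real (min_subcover_card T (join_covers F (\<lambda>s. preimage_cover T (\<alpha> s) \<U>))))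
            / real (card F))))"

section \<open>Actions on topological groups\<close>

locale topological_group = group X for X :: "('a, 'm) monoid_scheme" (structure) +
  fixes T :: "'a topology"
  assumes topspace_eq: "topspace T = carrier X"
    and continuous_mult: "continuous_map (prod_topology T T) T (\<lambda>(x, y). x \<otimes> y)"
    and continuous_inv: "continuous_map T T (\<lambda>x. inv x)"

text \<open>
  Members of \<^term>\<open>carrier (AutoGroup X)\<close> are extensional functions, so \<open>\<alpha> s\<close> is normalised
  to \<^const>\<open>undefined\<close> off the carrier; this loses no actions.
\<close>

definition continuous_automorphism_action ::
    "('g, 'm) monoid_scheme \<Rightarrow> ('a, 'n) monoid_scheme \<Rightarrow> 'a topology \<Rightarrow> ('g \<Rightarrow> 'a \<Rightarrow> 'a) \<Rightarrow> bool" where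
  "continuous_automorphism_action \<Gamma> X T \<alpha> \<longleftrightarrow>
     \<alpha> \<in> hom \<Gamma> (AutoGroup X) \<and>
     continuous_map (prod_topology (discrete_topology (carrier \<Gamma>)) T) T (\<lambda>(s, x). \<alpha> s x)"

definition sub_action :: "'a set \<Rightarrow> ('g \<Rightarrow> 'a \<Rightarrow> 'a) \<Rightarrow> 'g \<Rightarrow> 'a \<Rightarrow> 'a" where
  "sub_action Y \<alpha> s = restrict (\<alpha> s) Y"

definition quotient_action ::
    "('a, 'n) monoid_scheme \<Rightarrow> 'a set \<Rightarrow> ('g \<Rightarrow> 'a \<Rightarrow> 'a) \<Rightarrow> 'g \<Rightarrow> 'a set \<Rightarrow> 'a set" where
  "quotient_action X Y \<alpha> s = restrict (image (\<alpha> s)) (carrier (X Mod Y))"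

definition quotient_group_topology ::
    "('a, 'n) monoid_scheme \<Rightarrow> 'a topology \<Rightarrow> 'a set \<Rightarrow> 'a set topology" where
  "quotient_group_topology X T Y =
     topology (\<lambda>\<C>. \<C> \<subseteq> carrier (X Mod Y) \<and> openin T {x \<in> topspace T. Y #>\<^bsub>X\<^esub> x \<in> \<C>})"

lemma openin_quotient_group_topology:
  "openin (quotient_group_topology X T Y) \<C> \<longleftrightarrow>
     \<C> \<subseteq> carrier (X Mod Y) \<and> openin T {x \<in> topspace T. Y #>\<^bsub>X\<^esub> x \<in> \<C>}"
proof -
  have Int: "{x \<in> topspace T. Y #>\<^bsub>X\<^esub> x \<in> A \<inter> B} =
      {x \<in> topspace T. Y #>\<^bsub>X\<^esub> x \<in> A} \<inter> {x \<in> topspace T. Y #>\<^bsub>X\<^esub> x \<in> B}" for A B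
    by auto
  have Un: "{x \<in> topspace T. Y #>\<^bsub>X\<^esub> x \<in> \<Union>\<K>} =
      (\<Union>A\<in>\<K>. {x \<in> topspace T. Y #>\<^bsub>X\<^esub> x \<in> A})" for \<K>
    by auto
  have "istopology (\<lambda>\<C>. \<C> \<subseteq> carrier (X Mod Y) \<and> openin T {x \<in> topspace T. Y #>\<^bsub>X\<^esub> x \<in> \<C>})"
    unfolding istopology_def Int Un by (blast intro: openin_Int openin_Union)
  then show ?thesis
    by (simp add: quotient_group_topology_def)
qed

lemma (in topological_group) quotient_map_quotient_group_topology:
  "quotient_map T (quotient_group_topology X T Y) (\<lambda>x. Y #> x)"
proof -
  have "{x \<in> topspace T. Y #> x \<in> carrier (X Mod Y)} = topspace T"
    by (auto simp: topspace_eq carrier_FactGroup)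
  then have "openin (quotient_group_topology X T Y) (carrier (X Mod Y))"
    by (simp add: openin_quotient_group_topology)
  then have "topspace (quotient_group_topology X T Y) = carrier (X Mod Y)"
    by (metis openin_quotient_group_topology openin_subset openin_topspace subset_antisym)
  then show ?thesis
    by (auto simp: quotient_map_def openin_quotient_group_topology carrier_FactGroup topspace_eq)
qed

lemma quotient_action_coset:
  assumes "group \<Gamma>" "group X" "continuous_automorphism_action \<Gamma> X T \<alpha>" "subgroup Y X"
    and inv: "\<forall>s \<in> carrier \<Gamma>. \<forall>y \<in> Y. \<alpha> s y \<in> Y"
    and s: "s \<in> carrier \<Gamma>" and x: "x \<in> carrier X"
  shows "quotient_action X Y \<alpha> s (Y #>\<^bsub>X\<^esub> x) = Y #>\<^bsub>X\<^esub> \<alpha> s x"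
proof -
  interpret \<Gamma>: group \<Gamma> by fact
  interpret X: group X by fact
  interpret Y: subgroup Y X by fact
  have \<alpha>: "\<alpha> \<in> hom \<Gamma> (AutoGroup X)"
    using assms(3) by (simp add: continuous_automorphism_action_def)
  have aut: "\<alpha> t \<in> auto X" if "t \<in> carrier \<Gamma>" for t
    using \<alpha> that by (auto simp: hom_def AutoGroup_def)
  have hom: "\<alpha> s (y \<otimes>\<^bsub>X\<^esub> x) = \<alpha> s y \<otimes>\<^bsub>X\<^esub> \<alpha> s x" if "y \<in> Y" for y
    using aut[OF s] x that Y.subset by (auto simp: auto_def hom_def)
  have "\<alpha> (s \<otimes>\<^bsub>\<Gamma>\<^esub> inv\<^bsub>\<Gamma>\<^esub> s) = \<alpha> s \<otimes>\<^bsub>AutoGroup X\<^esub> \<alpha> (inv\<^bsub>\<Gamma>\<^esub> s)"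
    using \<alpha> s by (intro hom_mult) auto
  moreover have "\<alpha> \<one>\<^bsub>\<Gamma>\<^esub> = \<one>\<^bsub>AutoGroup X\<^esub>"
    using hom_one[OF \<alpha>] \<Gamma>.is_group X.AutoGroup by simp
  ultimately have "\<alpha> s \<otimes>\<^bsub>AutoGroup X\<^esub> \<alpha> (inv\<^bsub>\<Gamma>\<^esub> s) = \<one>\<^bsub>AutoGroup X\<^esub>"
    using s by simp
  then have comp: "compose (carrier X) (\<alpha> s) (\<alpha> (inv\<^bsub>\<Gamma>\<^esub> s)) = (\<lambda>x\<in>carrier X. x)"
    using s aut[OF s] aut[of "inv\<^bsub>\<Gamma>\<^esub> s"]
    by (simp add: AutoGroup_def BijGroup_def auto_def)
  have id: "\<alpha> s (\<alpha> (inv\<^bsub>\<Gamma>\<^esub> s) y) = y" if "y \<in> carrier X" for y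
    using fun_cong[OF comp, of y] that by (simp add: compose_def)
  have img: "\<alpha> s ` Y = Y"
  proof
    show "\<alpha> s ` Y \<subseteq> Y" using inv s by auto
    show "Y \<subseteq> \<alpha> s ` Y"
    proof
      fix y assume "y \<in> Y"
      then have "y = \<alpha> s (\<alpha> (inv\<^bsub>\<Gamma>\<^esub> s) y)" "\<alpha> (inv\<^bsub>\<Gamma>\<^esub> s) y \<in> Y"
        using id Y.subset inv s by auto
      then show "y \<in> \<alpha> s ` Y" by blast
    qed
  qed
  have "\<alpha> s ` (Y #>\<^bsub>X\<^esub> x) = (\<lambda>y. y \<otimes>\<^bsub>X\<^esub> \<alpha> s x) ` (\<alpha> s ` Y)"
    using hom by (force simp: r_coset_def)
  also have "\<dots> = Y #>\<^bsub>X\<^esub> \<alpha> s x"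
    unfolding img by (auto simp: r_coset_def)
  finally show ?thesis
    using x by (auto simp: quotient_action_def carrier_FactGroup)
qed

end

theory Submission
  imports Defs
begin

text \<open>
  Both inequalities are obtained by counting orbit segments.

  The join of the covers \<open>s\<^sup>-\<^sup>1\<U>\<close> over \<open>s \<in> F\<close> has as members the sets of points following a prescribed
  itinerary \<open>F \<rightarrow> \<U>\<close>, so the topological entropy is the growth rate of the number of itineraries that
  are needed to describe all points. In a compact group this number can be compared with the size
  of sets that are separated along \<open>F\<close> by a neighbourhood of the identity (\<open>card_separated_le\<close>,
  \<open>itinerary_number_le_card_separated\<close>). If \<open>S\<close> is separated in \<open>Y\<close> and \<open>S'\<close> is separated in \<open>X/Y\<close>,
  then the products of representatives of \<open>S'\<close> with elements of \<open>S\<close> are separated in \<open>X\<close>: a small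
  quotient of two of them is small in \<open>X/Y\<close>, so the representatives agree, and then it lies in \<open>Y\<close>.
  This gives \<open>h(X) \<ge> h(Y) + h(X/Y)\<close> (\<open>cover_entropy_superadditive\<close>).

  For the converse, fix finitely many finite sets \<open>A\<close> for which few \<open>A\<close>-itineraries, about
  \<open>exp (h(Y) |A|)\<close>, describe \<open>Y\<close>. By compactness of \<open>Y\<close> the same itineraries still describe a
  neighbourhood of \<open>Y\<close>, which may be taken to be the preimage of a neighbourhood \<open>Z\<close> of the identity
  of \<open>X/Y\<close>. If the sets \<open>A\<close> quasi-tile \<open>F\<close>, then combining the itineraries on the tiles describes all
  points whose image in \<open>X/Y\<close> stays in \<open>Z\<close> along \<open>F\<close>, at a cost of about \<open>exp (h(Y) |F|)\<close> itineraries.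
  Finally \<open>X\<close> is covered by about \<open>exp (h(X/Y) |F|)\<close> translates of the set of these points, because
  \<open>X/Y\<close> is covered by that many sets of points that follow each other up to \<open>Z\<close> along \<open>F\<close>. Hence
  \<open>h(X) \<le> h(Y) + h(X/Y)\<close> (\<open>cover_entropy_le_error\<close>).

  The combinatorial input is the quasi-tiling theorem of Ornstein and Weiss (\<open>quasi_tiling_exists\<close>).
  It also yields the existence of the limits that define entropy (\<open>Ornstein_Weiss\<close>). Limits along
  almost invariant sets are limits along a filter, so the calculus of limits is available for them.
\<close>

section \<open>The filter of almost invariant sets\<close>

definition invariant_filter :: "('g, 'm) monoid_scheme \<Rightarrow> 'g set filter" where
  "invariant_filter \<Gamma> =
     (INF (K, \<delta>) \<in> fin_subsets \<Gamma> \<times> {0<..}. principal {F. invariant_set \<Gamma> K \<delta> F})"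

lemma invariant_set_mono:
  assumes "invariant_set \<Gamma> L \<delta> F" "K \<subseteq> L" "\<delta> \<le> \<epsilon>"
  shows "invariant_set \<Gamma> K \<epsilon> F"
proof -
  have fin: "finite F" using assms(1) by (simp add: invariant_set_def fin_subsets_def)
  have "(1 - \<epsilon>) * real (card F) \<le> (1 - \<delta>) * real (card F)"
    using assms(3) by (intro mult_right_mono) auto
  also have "\<dots> \<le> real (card {s \<in> F. L #>\<^bsub>\<Gamma>\<^esub> s \<subseteq> F})"
    using assms(1) by (simp add: invariant_set_def)
  also have "\<dots> \<le> real (card {s \<in> F. K #>\<^bsub>\<Gamma>\<^esub> s \<subseteq> F})"
  proof -
    have "K #>\<^bsub>\<Gamma>\<^esub> s \<subseteq> L #>\<^bsub>\<Gamma>\<^esub> s" for s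
      using assms(2) unfolding r_coset_def by blast
    then show ?thesis
      using fin by (intro of_nat_mono card_mono) auto
  qed
  finally show ?thesis using assms(1) by (simp add: invariant_set_def)
qed

lemma (in group) eventually_invariant_filter:
  "eventually P (invariant_filter G) \<longleftrightarrow>
     (\<exists>K \<in> fin_subsets G. \<exists>\<delta>>0. \<forall>F. invariant_set G K \<delta> F \<longrightarrow> P F)"
proof -
  have "{\<one>} \<in> fin_subsets G" by (simp add: fin_subsets_def)
  then have ne: "fin_subsets G \<times> {0::real<..} \<noteq> {}"
    by auto
  have "eventually P (invariant_filter G) \<longleftrightarrow>
    (\<exists>b \<in> fin_subsets G \<times> {0<..}. eventually P (case b of (K, \<delta>) \<Rightarrow> principal {F. invariant_set G K \<delta> F}))"
    unfolding invariant_filter_def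
  proof (rule eventually_INF_base[OF ne])
    fix a b assume "a \<in> fin_subsets G \<times> {0::real<..}" "b \<in> fin_subsets G \<times> {0::real<..}"
    then have "(fst a \<union> fst b, min (snd a) (snd b)) \<in> fin_subsets G \<times> {0<..}"
      by (auto simp: fin_subsets_def)
    then show "\<exists>x\<in>fin_subsets G \<times> {0<..}. (case x of (K, \<delta>) \<Rightarrow> principal {F. invariant_set G K \<delta> F})
           \<le> inf (case a of (K, \<delta>) \<Rightarrow> principal {F. invariant_set G K \<delta> F})
                (case b of (K, \<delta>) \<Rightarrow> principal {F. invariant_set G K \<delta> F})"
      by (rule bexI[rotated]) (auto simp: case_prod_beta intro: invariant_set_mono)
  qed
  then show ?thesis
    by (auto simp: eventually_principal)
qed

lemma (in group) frequently_invariant_filter: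
  "frequently P (invariant_filter G) \<longleftrightarrow>
     (\<forall>K \<in> fin_subsets G. \<forall>\<delta>>0. \<exists>F. invariant_set G K \<delta> F \<and> P F)"
  unfolding frequently_def eventually_invariant_filter by blast

lemma (in group) eventually_invariant_filter_fin_subsets:
  "eventually (\<lambda>F. F \<in> fin_subsets G) (invariant_filter G)"
  unfolding eventually_invariant_filter
  by (intro bexI[of _ "{\<one>}"] exI[of _ 1]) (auto simp: invariant_set_def fin_subsets_def)

lemma invariant_filter_nontrivial:
  assumes "amenable_group \<Gamma>"
  shows "invariant_filter \<Gamma> \<noteq> bot"
proof -
  interpret group \<Gamma> using assms by (simp add: amenable_group_def)
  show ?thesis
    using assms by (auto simp: trivial_limit_def eventually_invariant_filter amenable_group_def)
qed

lemma (in group) invariant_tendsto_iff: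
  "invariant_tendsto G \<phi> c \<longleftrightarrow> (\<phi> \<longlongrightarrow> c) (invariant_filter G)"
  by (simp add: invariant_tendsto_def tendsto_iff eventually_invariant_filter dist_real_def)

lemma invariant_lim_eq:
  assumes "amenable_group \<Gamma>" "(\<phi> \<longlongrightarrow> c) (invariant_filter \<Gamma>)"
  shows "invariant_lim \<Gamma> \<phi> = c"
proof -
  interpret group \<Gamma> using assms by (simp add: amenable_group_def)
  show ?thesis
    using assms invariant_tendsto_unique[OF assms(1)]
    unfolding invariant_lim_def by (auto simp: invariant_tendsto_iff)
qed

section \<open>Quasi-tilings\<close>

definition tiled_part :: "('g, 'm) monoid_scheme \<Rightarrow> ('g set \<times> 'g) set \<Rightarrow> 'g set" where
  "tiled_part \<Gamma> Q = (\<Union>(T, c)\<in>Q. T #>\<^bsub>\<Gamma>\<^esub> c)"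

text \<open>
  A pair \<open>(T, c)\<close> stands for the tile \<open>Tc\<close>. The last inequality replaces disjointness of the tiles: the
  total size of the tiles exceeds the size of their union by a factor of at most \<open>1/(1 - \<epsilon>)\<close>. The part
  of \<open>F\<close> that is left uncovered is estimated separately.
\<close>
definition quasi_tiling ::
    "('g, 'm) monoid_scheme \<Rightarrow> real \<Rightarrow> 'g set set \<Rightarrow> 'g set \<Rightarrow> ('g set \<times> 'g) set \<Rightarrow> bool" where
  "quasi_tiling \<Gamma> \<epsilon> \<T> F Q \<longleftrightarrow>
     finite Q \<and> Q \<subseteq> \<T> \<times> carrier \<Gamma> \<and> tiled_part \<Gamma> Q \<subseteq> F \<and>
     (1 - \<epsilon>) * (\<Sum>(T, c)\<in>Q. real (card T)) \<le> real (card (tiled_part \<Gamma> Q))"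

context group
begin

lemma real_card_Diff:
  "finite A \<Longrightarrow> B \<subseteq> A \<Longrightarrow> real (card (A - B)) = real (card A) - real (card B)"
  by (simp add: card_Diff_subset finite_subset of_nat_diff card_mono)

lemma r_coset_subset_carrier: "A \<subseteq> carrier G \<Longrightarrow> c \<in> carrier G \<Longrightarrow> A #> c \<subseteq> carrier G"
  by (auto simp: r_coset_def)

lemma r_coset_eq_image: "A #> c = (\<lambda>a. a \<otimes> c) ` A"
  by (auto simp: r_coset_def)

lemma finite_r_coset: "finite A \<Longrightarrow> finite (A #> c)"
  by (simp add: r_coset_eq_image)

lemma card_r_coset: "A \<subseteq> carrier G \<Longrightarrow> c \<in> carrier G \<Longrightarrow> card (A #> c) = card A"
  unfolding r_coset_eq_image by (intro card_image inj_onI) (auto simp: right_cancel subset_iff)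

text \<open>
  Double counting of the pairs \<open>(t, c)\<close> with \<open>tc \<in> B\<close>: for a fixed \<open>t\<close>, different \<open>c\<close> give different
  points of \<open>B\<close>.
\<close>
lemma sum_card_translates_Int_le:
  assumes T: "finite T" "T \<subseteq> carrier G" and S: "finite S" "S \<subseteq> carrier G" and B: "finite B"
  shows "(\<Sum>c\<in>S. card ((T #> c) \<inter> B)) \<le> card T * card B"
proof -
  have "card ((T #> c) \<inter> B) = (\<Sum>t\<in>T. of_bool (t \<otimes> c \<in> B))" if "c \<in> S" for c
  proof -
    have "c \<in> carrier G" using that S by auto
    have "(T #> c) \<inter> B = (\<lambda>t. t \<otimes> c) ` {t \<in> T. t \<otimes> c \<in> B}"
      by (auto simp: r_coset_def)
    moreover have "inj_on (\<lambda>t. t \<otimes> c) {t \<in> T. t \<otimes> c \<in> B}"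
      using T \<open>c \<in> carrier G\<close> by (intro inj_onI) (auto simp: right_cancel subset_iff)
    ultimately show ?thesis
      using T by (simp add: card_image Int_def)
  qed
  then have "(\<Sum>c\<in>S. card ((T #> c) \<inter> B)) = (\<Sum>c\<in>S. \<Sum>t\<in>T. of_bool (t \<otimes> c \<in> B))"
    by simp
  also have "\<dots> = (\<Sum>t\<in>T. \<Sum>c\<in>S. of_bool (t \<otimes> c \<in> B))"
    by (rule sum.swap)
  also have "\<dots> \<le> (\<Sum>t\<in>T. card B)"
  proof (rule sum_mono)
    fix t assume "t \<in> T"
    then have "inj_on (\<lambda>c. t \<otimes> c) {c \<in> S. t \<otimes> c \<in> B}"
      using T S by (intro inj_onI) (auto simp: subset_iff)
    then have "card {c \<in> S. t \<otimes> c \<in> B} \<le> card B"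
      by (rule card_inj_on_le) (use B in auto)
    then show "(\<Sum>c\<in>S. of_bool (t \<otimes> c \<in> B)) \<le> card B"
      using S by (simp add: Int_def)
  qed
  finally show ?thesis by simp
qed

text \<open>
  Choose as many centres from \<open>S\<close> as possible while keeping the translates of \<open>T\<close> almost disjoint. By
  maximality every translate by an element of \<open>S\<close> meets the union \<open>B\<close> in at least \<open>\<epsilon> |T|\<close> points, so double
  counting gives \<open>\<epsilon> |T| |S| \<le> |T| |B|\<close>.
\<close>
lemma greedy_filling:
  fixes \<epsilon> :: real
  assumes T: "finite T" "T \<noteq> {}" "T \<subseteq> carrier G" and S: "finite S" "S \<subseteq> carrier G"
    and \<epsilon>: "0 \<le> \<epsilon>" "\<epsilon> \<le> 1"
  obtains C where "C \<subseteq> S" "(1 - \<epsilon>) * (real (card C) * real (card T)) \<le> real (card (\<Union>c\<in>C. T #> c))"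
    "\<epsilon> * real (card S) \<le> real (card (\<Union>c\<in>C. T #> c))"
proof -
  define ok where "ok C \<longleftrightarrow> C \<subseteq> S \<and>
    (1 - \<epsilon>) * (real (card C) * real (card T)) \<le> real (card (\<Union>c\<in>C. T #> c))" for C
  have "ok {}" by (simp add: ok_def)
  moreover have "card C \<le> card S" if "ok C" for C
    using that S by (auto simp: ok_def intro: card_mono)
  ultimately obtain C where C: "ok C" "\<And>D. ok D \<Longrightarrow> card D \<le> card C"
    using ex_has_greatest_nat[of ok "{}" card "Suc (card S)"] by (auto simp: less_Suc_eq_le)
  define B where "B = (\<Union>c\<in>C. T #> c)"
  have CS: "C \<subseteq> S" and finC: "finite C" using C S by (auto simp: ok_def intro: finite_subset)
  have finB: "finite B" using finC T by (auto simp: B_def finite_r_coset)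
  have "\<epsilon> * real (card T) \<le> real (card ((T #> c) \<inter> B))" if c: "c \<in> S" for c
  proof (cases "c \<in> C")
    case True
    then have "(T #> c) \<inter> B = T #> c" by (auto simp: B_def)
    then show ?thesis using T S c \<epsilon> card_r_coset[of T c] by (auto simp: mult_left_le_one_le)
  next
    case False
    then have "\<not> ok (insert c C)" using C(2)[of "insert c C"] finC by auto
    then have "real (card (B \<union> (T #> c))) < (1 - \<epsilon>) * (real (card C + 1) * real (card T))"
      using CS c False finC by (auto simp: ok_def B_def Un_commute algebra_simps)
    moreover have "real (card (B \<union> (T #> c))) + real (card ((T #> c) \<inter> B)) = real (card B) + real (card T)"
      using card_Un_Int[OF finB finite_r_coset[OF T(1)], of c] card_r_coset[of T c] T S c
      by (auto simp: Int_commute)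
    moreover have "(1 - \<epsilon>) * (real (card C) * real (card T)) \<le> real (card B)"
      using C by (simp add: ok_def B_def)
    ultimately show ?thesis by (simp add: algebra_simps)
  qed
  then have "(\<Sum>c\<in>S. \<epsilon> * real (card T)) \<le> (\<Sum>c\<in>S. real (card ((T #> c) \<inter> B)))"
    by (rule sum_mono)
  also have "\<dots> \<le> real (card T * card B)"
    using sum_card_translates_Int_le[OF T(1,3) S finB] by (metis of_nat_le_iff of_nat_sum)
  finally have "real (card T) * (\<epsilon> * real (card S)) \<le> real (card T) * real (card B)"
    by (simp add: algebra_simps)
  moreover have "real (card T) > 0" using T by (simp add: card_gt_0_iff)
  ultimately have "\<epsilon> * real (card S) \<le> real (card B)"
    by (simp only: mult_le_cancel_left_pos)
  then show ?thesis using that[of C] C(1) by (simp add: ok_def B_def)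
qed

text \<open>
  If \<open>ls = tc\<close> with \<open>s\<close> outside the tiles, then \<open>s = (l\<^sup>-\<^sup>1t)c\<close> with \<open>l\<^sup>-\<^sup>1t \<notin> T\<close>; since \<open>T\<close> is almost invariant
  under \<open>L\<^sup>-\<^sup>1\<close>, there are few such \<open>t\<close>.
\<close>
lemma card_boundary_le:
  assumes L: "finite L" "L \<subseteq> carrier G"
    and T: "invariant_set G ((\<lambda>l. inv l) ` L) \<beta> T"
    and C: "finite C" "C \<subseteq> carrier G"
  shows "real (card {s \<in> carrier G - (\<Union>c\<in>C. T #> c). (L #> s) \<inter> (\<Union>c\<in>C. T #> c) \<noteq> {}})
           \<le> real (card C) * (real (card L) * (\<beta> * real (card T)))"
proof -
  let ?K = "(\<lambda>l. inv l) ` L"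
  have finT: "finite T" and TG: "T \<subseteq> carrier G"
    using T by (auto simp: invariant_set_def fin_subsets_def)
  define D where "D = {t \<in> T. \<not> ?K #> t \<subseteq> T}"
  have "D = T - {t \<in> T. ?K #> t \<subseteq> T}" by (auto simp: D_def)
  then have "real (card D) = real (card T) - real (card {t \<in> T. ?K #> t \<subseteq> T})"
    using finT by (simp add: real_card_Diff)
  then have D: "real (card D) \<le> \<beta> * real (card T)"
    using T by (simp add: invariant_set_def algebra_simps)
  define E where "E = (\<Union>c\<in>C. (\<lambda>(l, t). inv l \<otimes> t \<otimes> c) ` (L \<times> D))"
  have finD: "finite D" using finT by (simp add: D_def)
  have sub: "{s \<in> carrier G - (\<Union>c\<in>C. T #> c). (L #> s) \<inter> (\<Union>c\<in>C. T #> c) \<noteq> {}} \<subseteq> E"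
  proof
    fix s assume "s \<in> {s \<in> carrier G - (\<Union>c\<in>C. T #> c). (L #> s) \<inter> (\<Union>c\<in>C. T #> c) \<noteq> {}}"
    then obtain l c t where s: "s \<in> carrier G" "s \<notin> (\<Union>c\<in>C. T #> c)"
      and l: "l \<in> L" and c: "c \<in> C" and t: "t \<in> T" and eq: "l \<otimes> s = t \<otimes> c"
      by (auto simp: r_coset_def)
    have G: "l \<in> carrier G" "c \<in> carrier G" "t \<in> carrier G" using l c t L C TG by auto
    have "s = inv l \<otimes> (l \<otimes> s)" using G s by (simp flip: m_assoc)
    then have s_eq: "s = inv l \<otimes> t \<otimes> c" using G by (simp add: eq m_assoc)
    then have "inv l \<otimes> t \<notin> T" using s c by (auto simp: r_coset_def)
    then have "t \<in> D" using t l by (auto simp: D_def r_coset_def)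
    then show "s \<in> E" using s_eq c l by (force simp: E_def)
  qed
  have "finite E" using C L finD by (auto simp: E_def)
  then have "card {s \<in> carrier G - (\<Union>c\<in>C. T #> c). (L #> s) \<inter> (\<Union>c\<in>C. T #> c) \<noteq> {}} \<le> card E"
    using sub by (rule card_mono)
  also have "\<dots> \<le> (\<Sum>c\<in>C. card ((\<lambda>(l, t). inv l \<otimes> t \<otimes> c) ` (L \<times> D)))"
    unfolding E_def using C by (intro card_UN_le)
  also have "\<dots> \<le> (\<Sum>c\<in>C. card L * card D)"
    using L finD by (intro sum_mono) (metis card_cartesian_product card_image_le finite_cartesian_product)
  finally have "real (card {s \<in> carrier G - (\<Union>c\<in>C. T #> c). (L #> s) \<inter> (\<Union>c\<in>C. T #> c) \<noteq> {}})
      \<le> real (card C * (card L * card D))" by (simp only: of_nat_le_iff sum_constant of_nat_id)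
  also have "\<dots> = real (card C) * (real (card L) * real (card D))" by simp
  also have "\<dots> \<le> real (card C) * (real (card L) * (\<beta> * real (card T)))"
    using D by (intro mult_left_mono) auto
  finally show ?thesis .
qed


text \<open>
  Removing from \<open>F\<close> almost disjoint translates of a set \<open>T\<close> that is much more invariant than required
  leaves an almost invariant set, as long as a definite proportion of \<open>F\<close> remains. This is what
  allows the remainder to be filled with further, smaller tiles.
\<close>
lemma remainder_invariant:
  assumes L: "L \<in> fin_subsets G"
    and F: "invariant_set G L \<eta>' F"
    and T: "invariant_set G ((\<lambda>l. inv l) ` L) \<beta> T"
    and C: "finite C" "C \<subseteq> carrier G" "(\<Union>c\<in>C. T #> c) \<subseteq> F"
      "(1 - \<epsilon>) * (real (card C) * real (card T)) \<le> real (card (\<Union>c\<in>C. T #> c))"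
    and \<epsilon>: "\<epsilon> < 1" and \<beta>: "0 \<le> \<beta>" and \<epsilon>': "0 \<le> \<epsilon>'"
    and rem: "\<epsilon>' * real (card F) < real (card (F - (\<Union>c\<in>C. T #> c)))"
    and small: "\<eta>' + real (card L) * \<beta> / (1 - \<epsilon>) \<le> \<eta> * \<epsilon>'" "0 \<le> \<eta>"
  shows "invariant_set G L \<eta> (F - (\<Union>c\<in>C. T #> c))"
proof -
  define B where "B = (\<Union>c\<in>C. T #> c)"
  have finF: "finite F" and FG: "F \<subseteq> carrier G"
    using F by (auto simp: invariant_set_def fin_subsets_def)
  have BF: "B \<subseteq> F" using C by (simp add: B_def)
  have finL: "finite L" and LG: "L \<subseteq> carrier G" using L by (auto simp: fin_subsets_def)
  define bad1 where "bad1 = {s \<in> F. \<not> L #> s \<subseteq> F}"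
  define bad2 where "bad2 = {s \<in> carrier G - B. (L #> s) \<inter> B \<noteq> {}}"
  have "bad1 = F - {s \<in> F. L #> s \<subseteq> F}" by (auto simp: bad1_def)
  then have "real (card bad1) = real (card F) - real (card {s \<in> F. L #> s \<subseteq> F})"
    using finF by (simp add: real_card_Diff)
  then have b1: "real (card bad1) \<le> \<eta>' * real (card F)"
    using F by (simp add: invariant_set_def algebra_simps)
  have "real (card C) * real (card T) \<le> real (card B) / (1 - \<epsilon>)"
    using C \<epsilon> by (simp add: B_def field_simps)
  also have "\<dots> \<le> real (card F) / (1 - \<epsilon>)"
    using \<epsilon> card_mono[OF finF BF] by (intro divide_right_mono) auto
  finally have CT: "real (card C) * real (card T) \<le> real (card F) / (1 - \<epsilon>)" .
  have "real (card bad2) \<le> real (card C) * (real (card L) * (\<beta> * real (card T)))"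
    unfolding bad2_def B_def by (rule card_boundary_le[OF finL LG T C(1,2)])
  also have "\<dots> = (real (card L) * \<beta>) * (real (card C) * real (card T))" by simp
  also have "\<dots> \<le> (real (card L) * \<beta>) * (real (card F) / (1 - \<epsilon>))"
    using CT \<beta> by (intro mult_left_mono) auto
  finally have b2: "real (card bad2) \<le> (real (card L) * \<beta> / (1 - \<epsilon>)) * real (card F)" by simp
  have sub: "(F - B) - {s \<in> F - B. L #> s \<subseteq> F - B} \<subseteq> bad1 \<union> (bad2 \<inter> F)"
    using FG by (auto simp: bad1_def bad2_def)
  have "real (card (F - B)) - real (card {s \<in> F - B. L #> s \<subseteq> F - B})
      = real (card ((F - B) - {s \<in> F - B. L #> s \<subseteq> F - B}))"
    using finF by (intro real_card_Diff[symmetric]) auto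
  also have "\<dots> \<le> real (card (bad1 \<union> (bad2 \<inter> F)))"
    using sub finF by (intro of_nat_mono card_mono) (auto simp: bad1_def)
  also have "\<dots> \<le> real (card bad1) + real (card (bad2 \<inter> F))"
    using card_Un_le[of bad1 "bad2 \<inter> F"] by (simp flip: of_nat_add)
  also have "\<dots> \<le> real (card bad1) + real (card bad2)"
  proof -
    have "finite bad2"
      unfolding bad2_def
    proof (rule finite_subset)
      show "{s \<in> carrier G - B. (L #> s) \<inter> B \<noteq> {}} \<subseteq> (\<lambda>(l, b). inv l \<otimes> b) ` (L \<times> B)"
      proof
        fix s assume "s \<in> {s \<in> carrier G - B. (L #> s) \<inter> B \<noteq> {}}"
        then obtain l where "s \<in> carrier G" "l \<in> L" "l \<otimes> s \<in> B"
          by (auto simp: r_coset_def)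
        moreover from this have "s = inv l \<otimes> (l \<otimes> s)" using LG by (auto simp flip: m_assoc)
        ultimately show "s \<in> (\<lambda>(l, b). inv l \<otimes> b) ` (L \<times> B)" by force
      qed
      show "finite ((\<lambda>(l, b). inv l \<otimes> b) ` (L \<times> B))"
        using finL finF BF by (auto intro: finite_subset)
    qed
    then show ?thesis by (auto intro!: card_mono)
  qed
  also have "\<dots> \<le> (\<eta>' + real (card L) * \<beta> / (1 - \<epsilon>)) * real (card F)"
    using b1 b2 by (simp add: algebra_simps)
  also have "\<dots> \<le> (\<eta> * \<epsilon>') * real (card F)"
    using small by (intro mult_right_mono) auto
  also have "\<dots> \<le> \<eta> * real (card (F - B))"
    using mult_left_mono[OF less_imp_le[OF rem] small(2)] by (simp add: B_def mult.assoc)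
  finally have "(1 - \<eta>) * real (card (F - B)) \<le> real (card {s \<in> F - B. L #> s \<subseteq> F - B})"
    by (simp add: algebra_simps)
  moreover have "F - B \<noteq> {}"
  proof
    assume "F - B = {}"
    then have "\<epsilon>' * real (card F) < 0"
      using rem by (simp only: B_def[symmetric] card.empty of_nat_0)
    then show False using \<epsilon>' by (simp add: mult_less_0_iff)
  qed
  ultimately show ?thesis
    using F by (auto simp: invariant_set_def fin_subsets_def B_def)
qed


lemma tiled_part_Un: "tiled_part G (Q \<union> R) = tiled_part G Q \<union> tiled_part G R"
  by (auto simp: tiled_part_def)

lemma quasi_tiling_mono:
  "quasi_tiling G \<epsilon> \<T> F Q \<Longrightarrow> \<T> \<subseteq> \<T>' \<Longrightarrow> F \<subseteq> F' \<Longrightarrow> quasi_tiling G \<epsilon> \<T>' F' Q"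
  unfolding quasi_tiling_def by blast

lemma quasi_tiling_Un:
  assumes Q: "quasi_tiling G \<epsilon> \<T> F Q" and R: "quasi_tiling G \<epsilon> \<T> (F - tiled_part G Q) R"
    and F: "finite F" and ne: "{} \<notin> \<T>"
  shows "quasi_tiling G \<epsilon> \<T> F (Q \<union> R)"
proof -
  have sub: "tiled_part G Q \<subseteq> F" "tiled_part G R \<subseteq> F - tiled_part G Q"
    using Q R by (auto simp: quasi_tiling_def)
  have "Q \<inter> R = {}"
  proof (rule equals0I)
    fix p assume p: "p \<in> Q \<inter> R"
    obtain T c where Tc: "p = (T, c)" by fastforce
    then have "T \<in> \<T>" using Q p by (auto simp: quasi_tiling_def)
    then have "T \<noteq> {}" using ne by metis
    then obtain t where "t \<in> T" by blast
    then have "t \<otimes> c \<in> tiled_part G Q \<inter> tiled_part G R"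
      using p Tc by (auto simp: tiled_part_def r_coset_def intro!: bexI[of _ p])
    then show False using sub by auto
  qed
  then have "(\<Sum>(T, c)\<in>Q \<union> R. real (card T)) =
      (\<Sum>(T, c)\<in>Q. real (card T)) + (\<Sum>(T, c)\<in>R. real (card T))"
    using Q R by (intro sum.union_disjoint) (auto simp: quasi_tiling_def)
  moreover have "card (tiled_part G (Q \<union> R)) = card (tiled_part G Q) + card (tiled_part G R)"
    unfolding tiled_part_Un using sub F
    by (intro card_Un_disjoint) (auto intro: finite_subset)
  ultimately show ?thesis
    using Q R by (auto simp: quasi_tiling_def tiled_part_Un algebra_simps)
qed

text \<open>
  Each round covers at least a proportion \<open>\<epsilon>/2\<close> of what is left. The induction adds the tile used
  \<^emph>\<open>first\<close>: it is chosen after the tiles for the remainder and is so invariant that the remainder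
  meets the requirements of the induction hypothesis, unless the remainder is already smaller
  than \<open>\<epsilon> |F|\<close>.
\<close>
lemma quasi_tiling_iterate:
  assumes P: "frequently P (invariant_filter G)" and \<epsilon>: "0 < \<epsilon>" "\<epsilon> \<le> 1/2"
  shows "\<exists>\<T>. finite \<T> \<and> \<T> \<subseteq> {T \<in> fin_subsets G. P T} \<and>
    (\<forall>\<^sub>F F in invariant_filter G. \<exists>Q. quasi_tiling G \<epsilon> \<T> F Q \<and>
       real (card (F - tiled_part G Q)) \<le> max \<epsilon> ((1 - \<epsilon> / 2) ^ n) * real (card F))"
proof (induction n)
  case 0
  have "quasi_tiling G \<epsilon> {} F {} \<and>
       real (card (F - tiled_part G {})) \<le> max \<epsilon> ((1 - \<epsilon> / 2) ^ 0) * real (card F)" for F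
    using \<epsilon> by (simp add: quasi_tiling_def tiled_part_def max_def)
  then show ?case by (intro exI[of _ "{}"]) (auto intro!: always_eventually)
next
  case (Suc n)
  then obtain \<T> where \<T>: "finite \<T>" "\<T> \<subseteq> {T \<in> fin_subsets G. P T}"
    and ev: "\<forall>\<^sub>F F in invariant_filter G. \<exists>Q. quasi_tiling G \<epsilon> \<T> F Q \<and>
       real (card (F - tiled_part G Q)) \<le> max \<epsilon> ((1 - \<epsilon> / 2) ^ n) * real (card F)"
    by blast
  then obtain L \<eta> where L: "L \<in> fin_subsets G" and \<eta>: "\<eta> > 0"
    and IH: "\<And>F. invariant_set G L \<eta> F \<Longrightarrow> \<exists>Q. quasi_tiling G \<epsilon> \<T> F Q \<and>
       real (card (F - tiled_part G Q)) \<le> max \<epsilon> ((1 - \<epsilon> / 2) ^ n) * real (card F)"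
    unfolding eventually_invariant_filter by blast
  have cardL: "real (card L) > 0" using L by (simp add: fin_subsets_def card_gt_0_iff)
  \<comment> \<open>This choice, together with that of \<open>\<eta>'\<close> below, gives \<open>\<eta>' + |L| \<beta> / (1 - \<epsilon>) \<le> \<eta>\<epsilon>\<close>, as \<open>1 - \<epsilon> \<ge> 1/2\<close>.\<close>
  define \<beta> where "\<beta> = \<eta> * \<epsilon> / (4 * real (card L))"
  have \<beta>: "\<beta> > 0" using \<eta> \<epsilon> cardL by (simp add: \<beta>_def)
  have Linv: "(\<lambda>l. inv l) ` L \<in> fin_subsets G" using L by (auto simp: fin_subsets_def)
  then obtain T where T: "invariant_set G ((\<lambda>l. inv l) ` L) \<beta> T" "P T"
    using P \<beta> unfolding frequently_invariant_filter by blast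
  then have T': "finite T" "T \<noteq> {}" "T \<subseteq> carrier G" "T \<in> fin_subsets G"
    by (auto simp: invariant_set_def fin_subsets_def)
  define \<eta>' where "\<eta>' = min (1/2) (\<eta> * \<epsilon> / 2)"
  have \<eta>': "\<eta>' > 0" using \<eta> \<epsilon> by (simp add: \<eta>'_def)
  have LT: "L \<union> T \<in> fin_subsets G" using L T' by (auto simp: fin_subsets_def)
  have "\<exists>Q. quasi_tiling G \<epsilon> (insert T \<T>) F Q \<and>
       real (card (F - tiled_part G Q)) \<le> max \<epsilon> ((1 - \<epsilon> / 2) ^ Suc n) * real (card F)"
    if F: "invariant_set G (L \<union> T) \<eta>' F" for F
  proof -
    have F': "finite F" "F \<subseteq> carrier G" using F by (auto simp: invariant_set_def fin_subsets_def)
    define S where "S = {s \<in> F. T #> s \<subseteq> F}"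
    have S: "finite S" "S \<subseteq> carrier G" using F' by (auto simp: S_def)
    have "invariant_set G T \<eta>' F" by (rule invariant_set_mono[OF F]) auto
    then have "(1 - \<eta>') * real (card F) \<le> real (card S)" by (simp add: invariant_set_def S_def)
    moreover have "(1/2) * real (card F) \<le> (1 - \<eta>') * real (card F)"
      by (intro mult_right_mono) (auto simp: \<eta>'_def)
    ultimately have cardS: "real (card F) \<le> 2 * real (card S)" by simp
    have "0 \<le> \<epsilon>" "\<epsilon> \<le> 1" using \<epsilon> by auto
    from greedy_filling[OF T'(1-3) S this] obtain C where C: "C \<subseteq> S"
      "(1 - \<epsilon>) * (real (card C) * real (card T)) \<le> real (card (\<Union>c\<in>C. T #> c))"
      "\<epsilon> * real (card S) \<le> real (card (\<Union>c\<in>C. T #> c))"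
      by blast
    define B where "B = (\<Union>c\<in>C. T #> c)"
    have CF: "finite C" "C \<subseteq> carrier G" "B \<subseteq> F"
      using C S by (auto simp: B_def S_def intro: finite_subset)
    have tB: "tiled_part G ({T} \<times> C) = B" by (auto simp: tiled_part_def B_def)
    have "{T} \<times> C = Pair T ` C" by auto
    then have "(\<Sum>(T, c)\<in>{T} \<times> C. real (card T)) = real (card C) * real (card T)"
      by (simp add: sum.reindex inj_on_def)
    then have Q1: "quasi_tiling G \<epsilon> (insert T \<T>) F ({T} \<times> C)"
      using C CF by (auto simp: quasi_tiling_def tB B_def)
    have "\<epsilon> / 2 * real (card F) \<le> \<epsilon> * real (card S)"
      using cardS \<epsilon> by simp
    then have remB: "real (card (F - B)) \<le> (1 - \<epsilon> / 2) * real (card F)"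
      using C(3) CF F' by (simp add: real_card_Diff B_def algebra_simps)
    show ?thesis
    proof (cases "real (card (F - B)) \<le> \<epsilon> * real (card F)")
      case True
      have "\<epsilon> * real (card F) \<le> max \<epsilon> ((1 - \<epsilon> / 2) ^ Suc n) * real (card F)"
        by (intro mult_right_mono) auto
      then show ?thesis using True Q1 by (intro exI[of _ "{T} \<times> C"]) (simp add: tB)
    next
      case False
      have "invariant_set G L \<eta> (F - B)"
        unfolding B_def
      proof (rule remainder_invariant[OF L _ T(1) CF(1,2)])
        show "invariant_set G L \<eta>' F" by (rule invariant_set_mono[OF F]) auto
        show "\<epsilon> * real (card F) < real (card (F - (\<Union>c\<in>C. T #> c)))"
          using False by (simp add: B_def)
        have "real (card L) * \<beta> / (1 - \<epsilon>) = \<eta> * \<epsilon> / 4 / (1 - \<epsilon>)" using cardL by (simp add: \<beta>_def)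
        also have "\<dots> \<le> \<eta> * \<epsilon> / 4 / (1/2)"
          using \<epsilon> \<eta> by (intro divide_left_mono) auto
        also have "\<dots> = \<eta> * \<epsilon> / 2" by simp
        finally have "real (card L) * \<beta> / (1 - \<epsilon>) \<le> \<eta> * \<epsilon> / 2" .
        moreover have "\<eta>' \<le> \<eta> * \<epsilon> / 2" by (simp add: \<eta>'_def)
        ultimately show "\<eta>' + real (card L) * \<beta> / (1 - \<epsilon>) \<le> \<eta> * \<epsilon>" by linarith
      qed (use C CF \<epsilon> \<beta> \<eta> in \<open>auto simp: B_def\<close>)
      then obtain R where R: "quasi_tiling G \<epsilon> \<T> (F - B) R"
        and remR: "real (card (F - B - tiled_part G R)) \<le> max \<epsilon> ((1 - \<epsilon> / 2) ^ n) * real (card (F - B))"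
        using IH by blast
      have "quasi_tiling G \<epsilon> (insert T \<T>) F ({T} \<times> C \<union> R)"
      proof (rule quasi_tiling_Un[OF Q1])
        show "quasi_tiling G \<epsilon> (insert T \<T>) (F - tiled_part G ({T} \<times> C)) R"
          unfolding tB by (rule quasi_tiling_mono[OF R]) auto
        show "{} \<notin> insert T \<T>" using T' \<T> by (auto simp: fin_subsets_def)
      qed (use F' in auto)
      moreover have "real (card (F - tiled_part G ({T} \<times> C \<union> R)))
          \<le> max \<epsilon> ((1 - \<epsilon> / 2) ^ Suc n) * real (card F)"
      proof -
        have "real (card (F - tiled_part G ({T} \<times> C \<union> R))) = real (card (F - B - tiled_part G R))"
          by (simp add: tiled_part_Un tB Diff_eq Int_assoc)
        also have "\<dots> \<le> max \<epsilon> ((1 - \<epsilon> / 2) ^ n) * ((1 - \<epsilon> / 2) * real (card F))"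
          using remR remB \<epsilon> by (elim order_trans) (auto intro!: mult_left_mono simp: le_max_iff_disj)
        also have "\<dots> = (max \<epsilon> ((1 - \<epsilon> / 2) ^ n) * (1 - \<epsilon> / 2)) * real (card F)" by simp
        also have "\<dots> \<le> max \<epsilon> ((1 - \<epsilon> / 2) ^ Suc n) * real (card F)"
        proof (rule mult_right_mono)
          have "\<epsilon> * (1 - \<epsilon> / 2) \<le> \<epsilon>" using \<epsilon> by (intro mult_left_le) auto
          then show "max \<epsilon> ((1 - \<epsilon> / 2) ^ n) * (1 - \<epsilon> / 2) \<le> max \<epsilon> ((1 - \<epsilon> / 2) ^ Suc n)"
            by (cases "\<epsilon> \<le> (1 - \<epsilon> / 2) ^ n") (auto simp: max_def mult.commute)
        qed simp
        finally show ?thesis .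
      qed
      ultimately show ?thesis by blast
    qed
  qed
  then show ?case
    unfolding eventually_invariant_filter using \<T> T(2) T' LT \<eta>'
    by (intro exI[of _ "insert T \<T>"]) blast
qed

text \<open>
  The predicate \<open>P\<close> selects the admissible tiles: they only have to occur among the sets of any
  prescribed invariance.
\<close>
theorem quasi_tiling_exists:
  assumes P: "frequently P (invariant_filter G)" and \<epsilon>: "0 < \<epsilon>" "\<epsilon> \<le> 1/2"
  obtains \<T> where "finite \<T>" "\<T> \<subseteq> {T \<in> fin_subsets G. P T}"
    "\<forall>\<^sub>F F in invariant_filter G. \<exists>Q. quasi_tiling G \<epsilon> \<T> F Q \<and>
       real (card (F - tiled_part G Q)) \<le> \<epsilon> * real (card F)"
proof -
  obtain n where "(1 - \<epsilon> / 2) ^ n < \<epsilon>"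
    using real_arch_pow_inv[of \<epsilon> "1 - \<epsilon> / 2"] \<epsilon> by auto
  then have "max \<epsilon> ((1 - \<epsilon> / 2) ^ n) = \<epsilon>" by simp
  then show ?thesis
    using quasi_tiling_iterate[OF assms, of n] that by auto
qed

section \<open>The Ornstein--Weiss lemma\<close>

text \<open>
  Subadditivity is only required inside \<open>F\<close>, and the bound for the translated tiles may hold for \<open>F\<close>
  alone: below, the function counts itineraries of a set of points that depends on \<open>F\<close>.
\<close>
lemma subadditive_le_quasi_tiling:
  fixes \<phi> :: "'a set \<Rightarrow> real"
  assumes Q: "quasi_tiling G \<epsilon> \<T> F Q" and rem: "real (card (F - tiled_part G Q)) \<le> \<epsilon> * real (card F)"
    and F: "finite F" and \<epsilon>: "\<epsilon> < 1"
    and empty: "\<phi> {} \<le> 0"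
    and sub: "\<And>A B. A \<subseteq> F \<Longrightarrow> B \<subseteq> F \<Longrightarrow> \<phi> (A \<union> B) \<le> \<phi> A + \<phi> B"
    and bound: "\<And>A. A \<subseteq> F \<Longrightarrow> \<phi> A \<le> M * real (card A)" "0 \<le> M"
    and tile: "\<And>T c. T \<in> \<T> \<Longrightarrow> c \<in> carrier G \<Longrightarrow> T #> c \<subseteq> F \<Longrightarrow> \<phi> (T #> c) \<le> l * real (card T)" "0 \<le> l"
  shows "\<phi> F \<le> (l / (1 - \<epsilon>) + M * \<epsilon>) * real (card F)"
proof -
  have QF: "finite Q" "Q \<subseteq> \<T> \<times> carrier G" "tiled_part G Q \<subseteq> F"
    "(1 - \<epsilon>) * (\<Sum>(T, c)\<in>Q. real (card T)) \<le> real (card (tiled_part G Q))"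
    using Q by (auto simp: quasi_tiling_def)
  have "\<phi> (tiled_part G R) \<le> (\<Sum>(T, c)\<in>R. l * real (card T))" if "R \<subseteq> Q" for R
    using finite_subset[OF that QF(1)] that
  proof (induction R)
    case empty
    then show ?case using assms(5) by (simp add: tiled_part_def)
  next
    case (insert p R)
    obtain T c where p: "p = (T, c)" by fastforce
    have "tiled_part G (insert p R) = (T #> c) \<union> tiled_part G R" by (auto simp: tiled_part_def p)
    moreover have "(T #> c) \<subseteq> F" "tiled_part G R \<subseteq> F" "T \<in> \<T>" "c \<in> carrier G"
      using insert.prems QF by (auto simp: p tiled_part_def)
    ultimately have "\<phi> (tiled_part G (insert p R)) \<le> l * real (card T) + \<phi> (tiled_part G R)"
      using sub[of "T #> c" "tiled_part G R"] tile(1)[of T c] by simp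
    then show ?case using insert by (simp add: p)
  qed
  from this[of Q] have "\<phi> (tiled_part G Q) \<le> l * (\<Sum>(T, c)\<in>Q. real (card T))"
    by (simp add: sum_distrib_left case_prod_beta)
  also have "\<dots> \<le> l * (real (card F) / (1 - \<epsilon>))"
  proof (rule mult_left_mono[OF _ tile(2)])
    have "(1 - \<epsilon>) * (\<Sum>(T, c)\<in>Q. real (card T)) \<le> real (card F)"
      using QF F by (elim order_trans) (auto intro: card_mono)
    then show "(\<Sum>(T, c)\<in>Q. real (card T)) \<le> real (card F) / (1 - \<epsilon>)"
      using \<epsilon> by (simp add: field_simps)
  qed
  finally have 1: "\<phi> (tiled_part G Q) \<le> l / (1 - \<epsilon>) * real (card F)" by simp
  have "\<phi> (F - tiled_part G Q) \<le> M * real (card (F - tiled_part G Q))" by (rule bound) auto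
  also have "\<dots> \<le> M * (\<epsilon> * real (card F))" using rem bound(2) by (rule mult_left_mono)
  finally have 2: "\<phi> (F - tiled_part G Q) \<le> M * \<epsilon> * real (card F)" by simp
  have "tiled_part G Q \<union> (F - tiled_part G Q) = F" using QF by auto
  then have "\<phi> F \<le> \<phi> (tiled_part G Q) + \<phi> (F - tiled_part G Q)"
    using sub[of "tiled_part G Q" "F - tiled_part G Q"] QF by auto
  then show ?thesis using 1 2 by (simp add: algebra_simps)
qed

end

lemma small_tiling_error:
  fixes c M \<epsilon> :: real
  assumes "0 < \<epsilon>"
  obtains e where "0 < e" "e \<le> 1/2" "(c + e) / (1 - e) + M * e < c + \<epsilon>"
proof -
  have "((\<lambda>e. (c + e) / (1 - e) + M * e) \<longlongrightarrow> (c + 0) / (1 - 0) + M * 0) (at_right 0)"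
    by (intro tendsto_intros) auto
  then have "\<forall>\<^sub>F e in at_right 0. (c + e) / (1 - e) + M * e < c + \<epsilon>"
    using assms by (intro order_tendstoD) auto
  moreover have "\<forall>\<^sub>F e in at_right 0. (e::real) < 1/2"
    by (intro order_tendstoD(2)[OF tendsto_ident_at]) auto
  moreover have "\<forall>\<^sub>F e in at_right 0. (0::real) < e" by (rule eventually_at_right_less)
  ultimately have "\<forall>\<^sub>F e in at_right 0. 0 < e \<and> e \<le> 1/2 \<and> (c + e) / (1 - e) + M * e < c + \<epsilon>"
    by eventually_elim auto
  then show ?thesis
    using that eventually_happens'[OF trivial_limit_at_right_real] by blast
qed

text \<open>
  Take for \<open>c\<close> the lower limit of \<open>\<phi> F / |F|\<close>. Tiles with ratio below \<open>c + e\<close> exist at every level of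
  invariance, and quasi-tiling by them bounds the ratio for all sufficiently invariant sets.
\<close>
theorem Ornstein_Weiss:
  fixes \<phi> :: "'g set \<Rightarrow> real"
  assumes am: "amenable_group \<Gamma>"
    and empty: "\<phi> {} \<le> 0"
    and sub: "\<And>A B. finite A \<Longrightarrow> finite B \<Longrightarrow> A \<subseteq> carrier \<Gamma> \<Longrightarrow> B \<subseteq> carrier \<Gamma> \<Longrightarrow> \<phi> (A \<union> B) \<le> \<phi> A + \<phi> B"
    and inv: "\<And>A c. finite A \<Longrightarrow> A \<subseteq> carrier \<Gamma> \<Longrightarrow> c \<in> carrier \<Gamma> \<Longrightarrow> \<phi> (A #>\<^bsub>\<Gamma>\<^esub> c) \<le> \<phi> A"
    and nonneg: "\<And>A. finite A \<Longrightarrow> A \<subseteq> carrier \<Gamma> \<Longrightarrow> 0 \<le> \<phi> A"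
    and bound: "\<And>A. finite A \<Longrightarrow> A \<subseteq> carrier \<Gamma> \<Longrightarrow> \<phi> A \<le> M * real (card A)"
  shows "\<exists>c\<ge>0. ((\<lambda>F. \<phi> F / real (card F)) \<longlongrightarrow> c) (invariant_filter \<Gamma>)"
proof -
  interpret group \<Gamma> using am by (simp add: amenable_group_def)
  let ?Fil = "invariant_filter \<Gamma>"
  have nt: "?Fil \<noteq> bot" by (rule invariant_filter_nontrivial[OF am])
  note evfin = eventually_invariant_filter_fin_subsets
  have M: "0 \<le> M" using nonneg[of "{\<one>\<^bsub>\<Gamma>\<^esub>}"] bound[of "{\<one>\<^bsub>\<Gamma>\<^esub>}"] by simp
  define \<psi> where "\<psi> F = \<phi> F / real (card F)" for F
  \<comment> \<open>The infimum of \<open>\<Lambda>\<close> is the lower limit of \<open>\<psi>\<close>.\<close>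
  define \<Lambda> where "\<Lambda> = {l. \<exists>\<^sub>F F in ?Fil. \<psi> F < l}"
  have \<psi>: "0 \<le> \<psi> F" "\<psi> F \<le> M" if "F \<in> fin_subsets \<Gamma>" for F
    using that nonneg[of F] bound[of F] by (auto simp: \<psi>_def fin_subsets_def field_simps card_gt_0_iff)
  have lb: "0 \<le> l" if "l \<in> \<Lambda>" for l
  proof -
    have "\<exists>\<^sub>F F in ?Fil. \<psi> F < l \<and> F \<in> fin_subsets \<Gamma>"
      using that evfin by (auto simp: \<Lambda>_def intro: frequently_eventually_frequently)
    then obtain F where "\<psi> F < l" "F \<in> fin_subsets \<Gamma>" using frequently_ex by blast
    then show ?thesis using \<psi>[of F] by simp
  qed
  have "\<forall>\<^sub>F F in ?Fil. \<psi> F < M + 1"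
    using evfin by eventually_elim (use \<psi> in force)
  then have ne: "M + 1 \<in> \<Lambda>" using nt by (auto simp: \<Lambda>_def intro: eventually_frequently)
  have bdd: "bdd_below \<Lambda>" using lb by (auto simp: bdd_below_def)
  define c where "c = Inf \<Lambda>"
  have c0: "0 \<le> c" unfolding c_def using ne lb by (intro cInf_greatest) auto
  have "(\<psi> \<longlongrightarrow> c) ?Fil"
  proof (rule order_tendstoI)
    fix a assume "a < c"
    then have "(a + c) / 2 \<notin> \<Lambda>" using cInf_lower[OF _ bdd, of "(a + c) / 2"] by (auto simp: c_def)
    then have "\<forall>\<^sub>F F in ?Fil. \<not> \<psi> F < (a + c) / 2" by (simp add: \<Lambda>_def frequently_def)
    then show "\<forall>\<^sub>F F in ?Fil. a < \<psi> F"
      by eventually_elim (use \<open>a < c\<close> in auto)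
  next
    fix a assume "c < a"
    then obtain e where e: "0 < e" "e \<le> 1/2" "(c + e) / (1 - e) + M * e < c + (a - c)"
      using small_tiling_error[of "a - c" c M] by auto
    obtain l where "l \<in> \<Lambda>" "l < c + e"
      using cInf_lessD[of \<Lambda> "c + e"] ne e by (auto simp: c_def)
    then have fr: "\<exists>\<^sub>F F in ?Fil. \<psi> F < c + e"
      unfolding \<Lambda>_def by (auto elim: frequently_elim1)
    obtain \<T> where "finite \<T>" and \<T>: "\<T> \<subseteq> {T \<in> fin_subsets \<Gamma>. \<psi> T < c + e}"
      and ev: "\<forall>\<^sub>F F in ?Fil. \<exists>Q. quasi_tiling \<Gamma> e \<T> F Q \<and>
         real (card (F - tiled_part \<Gamma> Q)) \<le> e * real (card F)"
      by (rule quasi_tiling_exists[OF fr e(1,2)])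
    show "\<forall>\<^sub>F F in ?Fil. \<psi> F < a"
      using ev evfin
    proof eventually_elim
      case (elim F)
      then obtain Q where Q: "quasi_tiling \<Gamma> e \<T> F Q"
         "real (card (F - tiled_part \<Gamma> Q)) \<le> e * real (card F)" by blast
      have F: "finite F" "F \<subseteq> carrier \<Gamma>" "card F > 0"
        using elim(2) by (auto simp: fin_subsets_def card_gt_0_iff)
      have "\<phi> F \<le> ((c + e) / (1 - e) + M * e) * real (card F)"
      proof (rule subadditive_le_quasi_tiling[where \<phi> = \<phi>, OF Q F(1) _ empty])
        fix A B assume "A \<subseteq> F" "B \<subseteq> F"
        then show "\<phi> (A \<union> B) \<le> \<phi> A + \<phi> B" using sub F by (meson finite_subset order_trans)
      next
        fix A assume "A \<subseteq> F"
        then show "\<phi> A \<le> M * real (card A)" using bound F by (meson finite_subset order_trans)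
      next
        fix T d assume T: "T \<in> \<T>" "d \<in> carrier \<Gamma>"
        then have T': "finite T" "T \<subseteq> carrier \<Gamma>" "card T > 0" "\<psi> T < c + e"
          using \<T> by (auto simp: fin_subsets_def card_gt_0_iff)
        then have "\<phi> T \<le> (c + e) * real (card T)" by (simp add: \<psi>_def field_simps)
        then show "\<phi> (T #>\<^bsub>\<Gamma>\<^esub> d) \<le> (c + e) * real (card T)"
          using inv[OF T'(1,2) T(2)] by simp
      qed (use e c0 M in auto)
      then have "\<psi> F \<le> (c + e) / (1 - e) + M * e" using F by (simp add: \<psi>_def field_simps)
      then show ?case using e by simp
    qed
  qed
  then show ?thesis using c0 unfolding \<psi>_def by blast
qed

section \<open>Itineraries\<close>

text \<open>
  Members of a join are recorded by the functions \<open>w\<close> that produce them, with irrelevant values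
  outside \<open>F\<close>, instead of as sets. Itineraries can be glued and translated directly, and the empty
  set \<open>F\<close> causes no exception.
\<close>
definition itinerary_cover ::
    "('g \<Rightarrow> 'a \<Rightarrow> 'a) \<Rightarrow> 'a set set \<Rightarrow> 'g set \<Rightarrow> 'a set \<Rightarrow> ('g \<Rightarrow> 'a set) set \<Rightarrow> bool" where
  "itinerary_cover \<alpha> \<U> F D \<Omega> \<longleftrightarrow>
     finite \<Omega> \<and> (\<forall>w\<in>\<Omega>. \<forall>s\<in>F. w s \<in> \<U>) \<and> (\<forall>x\<in>D. \<exists>w\<in>\<Omega>. \<forall>s\<in>F. \<alpha> s x \<in> w s)"

definition itinerary_number ::
    "('g \<Rightarrow> 'a \<Rightarrow> 'a) \<Rightarrow> 'a set set \<Rightarrow> 'g set \<Rightarrow> 'a set \<Rightarrow> nat" where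
  "itinerary_number \<alpha> \<U> F D = (LEAST n. \<exists>\<Omega>. itinerary_cover \<alpha> \<U> F D \<Omega> \<and> card \<Omega> = n)"

lemma itinerary_number_le: "itinerary_cover \<alpha> \<U> F D \<Omega> \<Longrightarrow> itinerary_number \<alpha> \<U> F D \<le> card \<Omega>"
  unfolding itinerary_number_def by (rule Least_le) auto

lemma itinerary_number_attained:
  assumes "itinerary_cover \<alpha> \<U> F D \<Omega>'"
  obtains \<Omega> where "itinerary_cover \<alpha> \<U> F D \<Omega>" "card \<Omega> = itinerary_number \<alpha> \<U> F D"
  using LeastI_ex[of "\<lambda>n. \<exists>\<Omega>. itinerary_cover \<alpha> \<U> F D \<Omega> \<and> card \<Omega> = n"] assms that
  unfolding itinerary_number_def by blast

lemma itinerary_cover_all: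
  assumes "finite \<U>" "finite F" "\<And>x s. x \<in> D \<Longrightarrow> s \<in> F \<Longrightarrow> \<alpha> s x \<in> \<Union>\<U>"
  shows "itinerary_cover \<alpha> \<U> F D (F \<rightarrow>\<^sub>E \<U>)"
proof -
  have "\<exists>w\<in>F \<rightarrow>\<^sub>E \<U>. \<forall>s\<in>F. \<alpha> s x \<in> w s" if "x \<in> D" for x
  proof -
    have "\<forall>s\<in>F. \<exists>U\<in>\<U>. \<alpha> s x \<in> U" using assms(3) that by auto
    then obtain w where "\<forall>s\<in>F. w s \<in> \<U> \<and> \<alpha> s x \<in> w s" by metis
    then show ?thesis by (intro bexI[of _ "restrict w F"]) auto
  qed
  then show ?thesis
    using assms by (auto simp: itinerary_cover_def finite_PiE)
qed

lemma itinerary_cover_Un: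
  assumes A: "itinerary_cover \<alpha> \<U> A D \<Omega>" and B: "itinerary_cover \<alpha> \<U> B D \<Omega>'"
  shows "itinerary_cover \<alpha> \<U> (A \<union> B) D ((\<lambda>(v, w) s. if s \<in> A then v s else w s) ` (\<Omega> \<times> \<Omega>'))"
  unfolding itinerary_cover_def
proof (intro conjI ballI)
  fix x assume "x \<in> D"
  then obtain v w where "v \<in> \<Omega>" "w \<in> \<Omega>'" "\<forall>s\<in>A. \<alpha> s x \<in> v s" "\<forall>s\<in>B. \<alpha> s x \<in> w s"
    using assms unfolding itinerary_cover_def by blast
  then show "\<exists>w\<in>(\<lambda>(v, w) s. if s \<in> A then v s else w s) ` (\<Omega> \<times> \<Omega>'). \<forall>s\<in>A \<union> B. \<alpha> s x \<in> w s"
    by (intro bexI[of _ "\<lambda>s. if s \<in> A then v s else w s"]) auto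
qed (use assms in \<open>auto simp: itinerary_cover_def\<close>)

lemma itinerary_number_Un_le:
  assumes A: "itinerary_cover \<alpha> \<U> A D \<Omega>" and B: "itinerary_cover \<alpha> \<U> B D \<Omega>'"
  shows "itinerary_number \<alpha> \<U> (A \<union> B) D \<le> itinerary_number \<alpha> \<U> A D * itinerary_number \<alpha> \<U> B D"
proof -
  obtain \<Omega>1 where 1: "itinerary_cover \<alpha> \<U> A D \<Omega>1" "card \<Omega>1 = itinerary_number \<alpha> \<U> A D"
    using itinerary_number_attained[OF A] .
  obtain \<Omega>2 where 2: "itinerary_cover \<alpha> \<U> B D \<Omega>2" "card \<Omega>2 = itinerary_number \<alpha> \<U> B D"
    using itinerary_number_attained[OF B] .
  have fin: "finite (\<Omega>1 \<times> \<Omega>2)" using 1 2 by (auto simp: itinerary_cover_def)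
  have "itinerary_number \<alpha> \<U> (A \<union> B) D
      \<le> card ((\<lambda>(v, w) s. if s \<in> A then v s else w s) ` (\<Omega>1 \<times> \<Omega>2))"
    by (rule itinerary_number_le[OF itinerary_cover_Un[OF 1(1) 2(1)]])
  also have "\<dots> \<le> card (\<Omega>1 \<times> \<Omega>2)" by (rule card_image_le[OF fin])
  finally show ?thesis by (simp add: card_cartesian_product 1 2)
qed

lemma itinerary_number_pos:
  assumes "itinerary_cover \<alpha> \<U> F D \<Omega>" "D \<noteq> {}"
  shows "0 < itinerary_number \<alpha> \<U> F D"
proof -
  obtain \<Omega>' where "itinerary_cover \<alpha> \<U> F D \<Omega>'" "card \<Omega>' = itinerary_number \<alpha> \<U> F D"
    using itinerary_number_attained[OF assms(1)] .
  then show ?thesis using assms(2) by (auto simp: itinerary_cover_def card_gt_0_iff)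
qed

lemma itinerary_number_empty: "D \<noteq> {} \<Longrightarrow> itinerary_number \<alpha> \<U> {} D = 1"
  using itinerary_number_le[of \<alpha> \<U> "{}" D "{\<lambda>_. {}}"] itinerary_number_pos[of \<alpha> \<U> "{}" D "{\<lambda>_. {}}"]
  by (auto simp: itinerary_cover_def)

text \<open>
  The itinerary \<open>w\<close> corresponds to the member \<open>\<Inter>s\<in>F. s\<^sup>-\<^sup>1(w s)\<close> of the join. Different itineraries may
  give the same member, which does not affect the minimum.
\<close>
lemma min_subcover_card_join_covers:
  assumes F: "F \<noteq> {}" and U: "\<And>U. U \<in> \<U> \<Longrightarrow> U \<subseteq> topspace T"
    and maps: "\<And>s x. s \<in> F \<Longrightarrow> x \<in> topspace T \<Longrightarrow> \<alpha> s x \<in> topspace T"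
  shows "min_subcover_card T (join_covers F (\<lambda>s. preimage_cover T (\<alpha> s) \<U>)) =
         itinerary_number \<alpha> \<U> F (topspace T)"
proof -
  let ?J = "join_covers F (\<lambda>s. preimage_cover T (\<alpha> s) \<U>)"
  define cell where "cell w = (\<Inter>s\<in>F. {x \<in> topspace T. \<alpha> s x \<in> w s})" for w
  have J: "?J = cell ` {w. \<forall>s\<in>F. w s \<in> \<U>}"
  proof (intro equalityI subsetI)
    fix A assume "A \<in> ?J"
    then obtain W where A: "A = (\<Inter>s\<in>F. W s)" and W: "\<forall>s\<in>F. W s \<in> preimage_cover T (\<alpha> s) \<U>"
      by (auto simp: join_covers_def)
    then have "\<forall>s\<in>F. \<exists>U\<in>\<U>. W s = {x \<in> topspace T. \<alpha> s x \<in> U}"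
      by (auto simp: preimage_cover_def)
    then obtain w where "\<forall>s\<in>F. w s \<in> \<U> \<and> W s = {x \<in> topspace T. \<alpha> s x \<in> w s}" by metis
    then show "A \<in> cell ` {w. \<forall>s\<in>F. w s \<in> \<U>}" by (auto simp: A cell_def)
  next
    fix A assume "A \<in> cell ` {w. \<forall>s\<in>F. w s \<in> \<U>}"
    then obtain w where w: "A = cell w" "\<forall>s\<in>F. w s \<in> \<U>" by blast
    show "A \<in> ?J"
      unfolding join_covers_def
    proof (intro CollectI exI conjI)
      show "A = (\<Inter>s\<in>F. {x \<in> topspace T. \<alpha> s x \<in> w s})" by (simp add: w cell_def)
      show "\<forall>s\<in>F. {x \<in> topspace T. \<alpha> s x \<in> w s} \<in> preimage_cover T (\<alpha> s) \<U>"
        using w(2) by (auto simp: preimage_cover_def)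
    qed
  qed
  have mem: "x \<in> cell w \<longleftrightarrow> x \<in> topspace T \<and> (\<forall>s\<in>F. \<alpha> s x \<in> w s)" for x w
    using F by (auto simp: cell_def)
  have 1: "\<exists>\<Omega>. itinerary_cover \<alpha> \<U> F (topspace T) \<Omega> \<and> card \<Omega> = card \<W>"
    if W: "\<W> \<subseteq> ?J" "finite \<W>" "\<Union>\<W> = topspace T" for \<W>
  proof -
    have "\<forall>A\<in>\<W>. \<exists>w. (\<forall>s\<in>F. w s \<in> \<U>) \<and> cell w = A" using W(1) by (auto simp: J)
    then obtain f where f: "\<forall>A\<in>\<W>. (\<forall>s\<in>F. f A s \<in> \<U>) \<and> cell (f A) = A" by metis
    then have "inj_on f \<W>" by (metis inj_onI)
    moreover have "itinerary_cover \<alpha> \<U> F (topspace T) (f ` \<W>)"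
      unfolding itinerary_cover_def
    proof (intro conjI ballI)
      fix x assume "x \<in> topspace T"
      then obtain A where "A \<in> \<W>" "x \<in> A" using W by auto
      then show "\<exists>w\<in>f ` \<W>. \<forall>s\<in>F. \<alpha> s x \<in> w s" using f mem[of x "f A"] by auto
    qed (use f W in auto)
    ultimately show ?thesis by (auto intro!: exI[of _ "f ` \<W>"] simp: card_image)
  qed
  have 2: "\<exists>\<W>\<subseteq>?J. finite \<W> \<and> \<Union>\<W> = topspace T \<and> card \<W> \<le> card \<Omega>"
    if "itinerary_cover \<alpha> \<U> F (topspace T) \<Omega>" for \<Omega>
    using that
    by (intro exI[of _ "cell ` \<Omega>"]) (auto simp: J itinerary_cover_def mem card_image_le)
  show ?thesis
  proof (cases "\<exists>\<Omega>. itinerary_cover \<alpha> \<U> F (topspace T) \<Omega>")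
    case True
    then obtain \<Omega> where \<Omega>: "itinerary_cover \<alpha> \<U> F (topspace T) \<Omega>"
      "card \<Omega> = itinerary_number \<alpha> \<U> F (topspace T)"
      using itinerary_number_attained by metis
    let ?P = "\<lambda>n. \<exists>\<W>\<subseteq>?J. finite \<W> \<and> \<Union>\<W> = topspace T \<and> card \<W> = n"
    obtain \<W> where \<W>: "\<W> \<subseteq> ?J" "finite \<W>" "\<Union>\<W> = topspace T" "card \<W> \<le> card \<Omega>"
      using 2[OF \<Omega>(1)] by blast
    then have P: "?P (card \<W>)" by blast
    then have "min_subcover_card T ?J \<le> card \<W>"
      unfolding min_subcover_card_def by (rule Least_le)
    moreover have "?P (min_subcover_card T ?J)"
      unfolding min_subcover_card_def by (rule LeastI[of ?P, OF P])
    then obtain \<Omega>' where "itinerary_cover \<alpha> \<U> F (topspace T) \<Omega>'" "card \<Omega>' = min_subcover_card T ?J"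
      using 1 by metis
    ultimately show ?thesis
      using itinerary_number_le[of \<alpha> \<U> F "topspace T" \<Omega>'] \<W> \<Omega> by simp
  next
    case False
    then have n1: "\<not> (\<exists>\<W>\<subseteq>?J. finite \<W> \<and> \<Union>\<W> = topspace T \<and> card \<W> = n)" for n
    proof (rule contrapos_nn)
      assume "\<exists>\<W>\<subseteq>?J. finite \<W> \<and> \<Union>\<W> = topspace T \<and> card \<W> = n"
      then obtain \<W> where "\<W> \<subseteq> ?J" "finite \<W>" "\<Union>\<W> = topspace T" by blast
      from 1[OF this] show "\<exists>\<Omega>. itinerary_cover \<alpha> \<U> F (topspace T) \<Omega>" by blast
    qed
    have n2: "\<not> (\<exists>\<Omega>. itinerary_cover \<alpha> \<U> F (topspace T) \<Omega> \<and> card \<Omega> = n)" for n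
      using False by blast
    show ?thesis
      unfolding min_subcover_card_def itinerary_number_def by (simp only: n1 n2)
  qed
qed

section \<open>Topological groups\<close>

lemma compact_space_pointwise_subcover:
  assumes "compact_space T" "\<And>x. x \<in> topspace T \<Longrightarrow> openin T (A x)" "\<And>x. x \<in> topspace T \<Longrightarrow> x \<in> A x"
  obtains P where "finite P" "P \<subseteq> topspace T" "topspace T \<subseteq> (\<Union>p\<in>P. A p)"
proof -
  have "(\<forall>U\<in>A ` topspace T. openin T U) \<and> topspace T \<subseteq> \<Union>(A ` topspace T)"
    using assms(2,3) by blast
  then obtain \<F> where "finite \<F>" "\<F> \<subseteq> A ` topspace T" "topspace T \<subseteq> \<Union>\<F>"
    using assms(1) unfolding compact_space_alt by meson
  moreover from finite_subset_image[OF this(1,2)] obtain P where "P \<subseteq> topspace T" "finite P" "\<F> = A ` P"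
    by blast
  ultimately show ?thesis using that by blast
qed

context topological_group
begin

lemma openin_nbhd_product:
  assumes "openin T U" "x \<in> carrier X" "y \<in> carrier X" "x \<otimes> y \<in> U"
  obtains A B where "openin T A" "openin T B" "x \<in> A" "y \<in> B" "\<And>a b. a \<in> A \<Longrightarrow> b \<in> B \<Longrightarrow> a \<otimes> b \<in> U"
proof -
  have "openin (prod_topology T T) {p \<in> topspace (prod_topology T T). (case p of (x, y) \<Rightarrow> x \<otimes> y) \<in> U}"
    by (rule openin_continuous_map_preimage[OF continuous_mult assms(1)])
  then obtain A B where "openin T A" "openin T B" "x \<in> A" "y \<in> B"
    "A \<times> B \<subseteq> {p \<in> topspace (prod_topology T T). (case p of (x, y) \<Rightarrow> x \<otimes> y) \<in> U}"
    unfolding openin_prod_topology_alt using assms by (force simp: topspace_eq)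
  then have "\<And>a b. a \<in> A \<Longrightarrow> b \<in> B \<Longrightarrow> a \<otimes> b \<in> U" by auto
  with that show ?thesis using \<open>openin T A\<close> \<open>openin T B\<close> \<open>x \<in> A\<close> \<open>y \<in> B\<close> by blast
qed

lemma openin_inv_preimage: "openin T U \<Longrightarrow> openin T {x \<in> carrier X. inv x \<in> U}"
  using openin_continuous_map_preimage[OF continuous_inv] by (simp add: topspace_eq)

lemma openin_subset_carrier: "openin T U \<Longrightarrow> U \<subseteq> carrier X"
  using openin_subset topspace_eq by metis

lemma continuous_left_translation:
  assumes "a \<in> carrier X" shows "continuous_map T T (\<lambda>x. a \<otimes> x)"
proof -
  have "continuous_map T (prod_topology T T) (\<lambda>x. (a, x))"
    using assms by (intro continuous_map_pairedI) (auto simp: topspace_eq)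
  from continuous_map_compose[OF this continuous_mult] show ?thesis by (simp add: o_def)
qed

lemma openin_left_translate:
  assumes "openin T U" "a \<in> carrier X" shows "openin T {x \<in> carrier X. inv a \<otimes> x \<in> U}"
  using openin_continuous_map_preimage[OF continuous_left_translation assms(1), of "inv a"] assms(2)
  by (simp add: topspace_eq)

text \<open>
  The group version of the Lebesgue number lemma. Symmetry of \<open>W\<close> makes \<open>W\<close>-closeness a symmetric
  relation.
\<close>
lemma Lebesgue_neighbourhood:
  assumes cpt: "compact_space T" and U: "finite_open_cover T \<U>"
  obtains W where "openin T W" "\<one> \<in> W" "\<And>w. w \<in> W \<Longrightarrow> inv w \<in> W"
    "\<And>x. x \<in> carrier X \<Longrightarrow> \<exists>U\<in>\<U>. \<forall>w\<in>W. x \<otimes> w \<in> U"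
proof -
  have "\<exists>A B. openin T A \<and> openin T B \<and> x \<in> A \<and> \<one> \<in> B \<and> (\<exists>U\<in>\<U>. \<forall>a\<in>A. \<forall>b\<in>B. a \<otimes> b \<in> U)"
    if "x \<in> carrier X" for x
  proof -
    obtain U where "U \<in> \<U>" "x \<in> U" using U \<open>x \<in> carrier X\<close> by (auto simp: finite_open_cover_def topspace_eq)
    moreover from this have "openin T U" using U by (auto simp: finite_open_cover_def)
    ultimately show ?thesis
      using openin_nbhd_product[of U x \<one>] that by (metis one_closed r_one)
  qed
  then obtain A B where AB: "\<And>x. x \<in> carrier X \<Longrightarrow> openin T (A x) \<and> openin T (B x) \<and> x \<in> A x \<and> \<one> \<in> B x
      \<and> (\<exists>U\<in>\<U>. \<forall>a\<in>A x. \<forall>b\<in>B x. a \<otimes> b \<in> U)"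
    by metis
  obtain P where P: "finite P" "P \<subseteq> carrier X" "carrier X \<subseteq> (\<Union>p\<in>P. A p)"
    using compact_space_pointwise_subcover[OF cpt, of A] AB unfolding topspace_eq by blast
  have "P \<noteq> {}" using P(3) one_closed by blast
  define W0 where "W0 = (\<Inter>p\<in>P. B p)"
  define W where "W = W0 \<inter> {x \<in> carrier X. inv x \<in> W0}"
  have "openin T W0" unfolding W0_def using P AB \<open>P \<noteq> {}\<close> by (intro openin_INT2) auto
  then have "openin T W" unfolding W_def by (intro openin_Int openin_inv_preimage)
  moreover have "\<one> \<in> W" using P AB by (auto simp: W_def W0_def)
  moreover have "inv w \<in> W" if "w \<in> W" for w using that by (auto simp: W_def)
  moreover have "\<exists>U\<in>\<U>. \<forall>w\<in>W. x \<otimes> w \<in> U" if x: "x \<in> carrier X" for x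
  proof -
    obtain p where "p \<in> P" "x \<in> A p" using P x by auto
    moreover from this obtain U where "U \<in> \<U>" "\<forall>a\<in>A p. \<forall>b\<in>B p. a \<otimes> b \<in> U" using AB P by blast
    ultimately show ?thesis by (intro bexI[of _ U]) (auto simp: W_def W0_def)
  qed
  ultimately show ?thesis using that by blast
qed

text \<open>
  Translates of a neighbourhood \<open>V\<close> with \<open>V\<^sup>-\<^sup>1V \<subseteq> W\<close>.
\<close>
lemma fine_cover:
  assumes cpt: "compact_space T" and W: "openin T W" "\<one> \<in> W"
  obtains \<U> where "finite_open_cover T \<U>" "\<And>U a b. U \<in> \<U> \<Longrightarrow> a \<in> U \<Longrightarrow> b \<in> U \<Longrightarrow> inv a \<otimes> b \<in> W"
proof -
  obtain A B where AB: "openin T A" "openin T B" "\<one> \<in> A" "\<one> \<in> B" "\<And>a b. a \<in> A \<Longrightarrow> b \<in> B \<Longrightarrow> a \<otimes> b \<in> W"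
    using openin_nbhd_product[OF W(1), of \<one> \<one>] W(2) by auto
  define V where "V = {x \<in> carrier X. inv x \<in> A} \<inter> B"
  have V: "openin T V" "\<one> \<in> V" "V \<subseteq> carrier X"
    using AB openin_inv_preimage by (auto simp: V_def)
  have VW: "inv a \<otimes> b \<in> W" if "a \<in> V" "b \<in> V" for a b using that AB by (auto simp: V_def)
  define tr where "tr a = {x \<in> carrier X. inv a \<otimes> x \<in> V}" for a
  have op: "openin T (tr a)" if "a \<in> carrier X" for a
    unfolding tr_def by (rule openin_left_translate[OF V(1) that])
  have self: "a \<in> tr a" if "a \<in> carrier X" for a using that V by (simp add: tr_def)
  obtain P where P: "finite P" "P \<subseteq> carrier X" "carrier X \<subseteq> (\<Union>p\<in>P. tr p)"
    using compact_space_pointwise_subcover[OF cpt, of tr] op self unfolding topspace_eq by blast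
  have "tr p \<subseteq> carrier X" for p by (auto simp: tr_def)
  then have "finite_open_cover T (tr ` P)"
    using P op by (auto simp: finite_open_cover_def topspace_eq)
  moreover have "inv a \<otimes> b \<in> W" if "U \<in> tr ` P" "a \<in> U" "b \<in> U" for U a b
  proof -
    obtain q where q: "q \<in> P" "U = tr q" using \<open>U \<in> tr ` P\<close> by (rule imageE)
    then obtain p where p: "p \<in> carrier X" and ab: "a \<in> tr p" "b \<in> tr p"
      using P(2) \<open>a \<in> U\<close> \<open>b \<in> U\<close> by auto
    then have "a \<in> carrier X" "b \<in> carrier X" and "inv (inv p \<otimes> a) \<otimes> (inv p \<otimes> b) \<in> W"
      using VW by (auto simp: tr_def)
    moreover from this p have "inv (inv p \<otimes> a) \<otimes> (inv p \<otimes> b) = inv a \<otimes> (p \<otimes> (inv p \<otimes> b))"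
      by (simp add: inv_mult_group m_assoc)
    moreover from calculation p have "p \<otimes> (inv p \<otimes> b) = b" by (simp flip: m_assoc)
    ultimately show ?thesis by simp
  qed
  ultimately show ?thesis using that by blast
qed

end

section \<open>Actions on compact groups and separated sets\<close>

locale compact_group_action =
  topological_group X T for \<Gamma> :: "('g, 'm) monoid_scheme" and X :: "('a, 'n) monoid_scheme" (structure) and T +
  fixes \<alpha> :: "'g \<Rightarrow> 'a \<Rightarrow> 'a"
  assumes amenable: "amenable_group \<Gamma>"
    and compact: "compact_space T"
    and action_hom: "s \<in> carrier \<Gamma> \<Longrightarrow> \<alpha> s \<in> hom X X"
    and action_continuous: "s \<in> carrier \<Gamma> \<Longrightarrow> continuous_map T T (\<alpha> s)"
    and action_mult: "s \<in> carrier \<Gamma> \<Longrightarrow> t \<in> carrier \<Gamma> \<Longrightarrow> x \<in> carrier X \<Longrightarrow> \<alpha> (s \<otimes>\<^bsub>\<Gamma>\<^esub> t) x = \<alpha> s (\<alpha> t x)"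
begin

sublocale \<Gamma>: group \<Gamma> using amenable by (simp add: amenable_group_def)

lemma action_closed: "s \<in> carrier \<Gamma> \<Longrightarrow> x \<in> carrier X \<Longrightarrow> \<alpha> s x \<in> carrier X"
  using action_hom by (auto simp: hom_def)

lemma action_m: "s \<in> carrier \<Gamma> \<Longrightarrow> x \<in> carrier X \<Longrightarrow> y \<in> carrier X \<Longrightarrow> \<alpha> s (x \<otimes> y) = \<alpha> s x \<otimes> \<alpha> s y"
  using action_hom by (auto simp: hom_def)

lemma action_one: "s \<in> carrier \<Gamma> \<Longrightarrow> \<alpha> s \<one> = \<one>"
  using hom_one[OF action_hom] is_group by blast

lemma action_inv: "s \<in> carrier \<Gamma> \<Longrightarrow> x \<in> carrier X \<Longrightarrow> \<alpha> s (inv x) = inv (\<alpha> s x)"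
  using group_hom.hom_inv[of X X "\<alpha> s"] action_hom
  by (simp add: group_hom_def group_hom_axioms_def is_group)

definition separated :: "'a set \<Rightarrow> 'g set \<Rightarrow> 'a set \<Rightarrow> bool" where
  "separated W F S \<longleftrightarrow>
     S \<subseteq> carrier X \<and> (\<forall>x\<in>S. \<forall>y\<in>S. (\<forall>s\<in>F. \<alpha> s (inv x \<otimes> y) \<in> W) \<longrightarrow> x = y)"

lemma finite_open_cover_itineraries:
  assumes "finite_open_cover T \<U>" "finite F" "F \<subseteq> carrier \<Gamma>" "D \<subseteq> carrier X"
  shows "itinerary_cover \<alpha> \<U> F D (F \<rightarrow>\<^sub>E \<U>)"
  using assms action_closed
  by (intro itinerary_cover_all) (auto simp: finite_open_cover_def topspace_eq)

text \<open>
  Two points with the same itinerary through a cover by \<open>W\<close>-small sets are \<open>W\<close>-close along \<open>F\<close>, so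
  separated points have different itineraries.
\<close>
lemma card_separated_le:
  assumes W: "openin T W" "\<one> \<in> W"
  obtains \<U> where "finite_open_cover T \<U>"
    "\<And>F S. finite F \<Longrightarrow> F \<subseteq> carrier \<Gamma> \<Longrightarrow> separated W F S \<Longrightarrow>
       finite S \<and> card S \<le> itinerary_number \<alpha> \<U> F (carrier X)"
proof -
  obtain \<U> where \<U>: "finite_open_cover T \<U>"
    and small: "\<And>U a b. U \<in> \<U> \<Longrightarrow> a \<in> U \<Longrightarrow> b \<in> U \<Longrightarrow> inv a \<otimes> b \<in> W"
    using fine_cover[OF compact W] by blast
  have "finite S \<and> card S \<le> itinerary_number \<alpha> \<U> F (carrier X)"
    if F: "finite F" "F \<subseteq> carrier \<Gamma>" and S: "separated W F S" for F S
  proof -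
    obtain \<Omega> where \<Omega>: "itinerary_cover \<alpha> \<U> F (carrier X) \<Omega>"
      "card \<Omega> = itinerary_number \<alpha> \<U> F (carrier X)"
      using itinerary_number_attained[OF finite_open_cover_itineraries[OF \<U> F subset_refl]] .
    have SX: "S \<subseteq> carrier X" using S by (simp add: separated_def)
    then have "\<forall>x\<in>S. \<exists>w\<in>\<Omega>. \<forall>s\<in>F. \<alpha> s x \<in> w s" using \<Omega>(1) by (auto simp: itinerary_cover_def)
    then obtain f where f: "\<forall>x\<in>S. f x \<in> \<Omega> \<and> (\<forall>s\<in>F. \<alpha> s x \<in> f x s)" by metis
    have "inj_on f S"
    proof (rule inj_onI)
      fix x y assume xy: "x \<in> S" "y \<in> S" "f x = f y"
      have "\<alpha> s (inv x \<otimes> y) \<in> W" if s: "s \<in> F" for s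
      proof -
        have "\<alpha> s x \<in> f x s" "\<alpha> s y \<in> f x s" "f x s \<in> \<U>"
          using f xy s \<Omega>(1) by (auto simp: itinerary_cover_def)
        then have "inv (\<alpha> s x) \<otimes> \<alpha> s y \<in> W" using small by blast
        moreover have "s \<in> carrier \<Gamma>" "x \<in> carrier X" "y \<in> carrier X" using s F xy SX by auto
        ultimately show ?thesis by (simp add: action_m action_inv)
      qed
      then show "x = y" using S xy by (auto simp: separated_def)
    qed
    moreover have "f ` S \<subseteq> \<Omega>" "finite \<Omega>" using f \<Omega>(1) by (auto simp: itinerary_cover_def)
    ultimately show ?thesis
      using \<Omega>(2) by (metis card_image card_mono finite_imageD finite_subset)
  qed
  then show ?thesis using that \<U> by blast
qed

text \<open>
  A maximal separated set \<open>S\<close> spans: every point is \<open>W\<close>-close along \<open>F\<close> to some \<open>x \<in> S\<close>. If \<open>W\<close> is a Lebesgue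
  neighbourhood of the cover, one itinerary serves all points close to \<open>x\<close>.
\<close>
lemma itinerary_number_le_card_separated:
  assumes \<U>: "finite_open_cover T \<U>"
  obtains W where "openin T W" "\<one> \<in> W"
    "\<And>F. finite F \<Longrightarrow> F \<subseteq> carrier \<Gamma> \<Longrightarrow>
       \<exists>S. finite S \<and> separated W F S \<and> itinerary_number \<alpha> \<U> F (carrier X) \<le> card S"
proof -
  obtain W where W: "openin T W" "\<one> \<in> W" and sym: "\<And>w. w \<in> W \<Longrightarrow> inv w \<in> W"
    and leb: "\<And>x. x \<in> carrier X \<Longrightarrow> \<exists>U\<in>\<U>. \<forall>w\<in>W. x \<otimes> w \<in> U"
    using Lebesgue_neighbourhood[OF compact \<U>] by blast
  obtain u where u: "\<And>x. x \<in> carrier X \<Longrightarrow> u x \<in> \<U> \<and> (\<forall>w\<in>W. x \<otimes> w \<in> u x)"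
    using leb by metis
  obtain \<V> where \<V>: "\<And>F S. finite F \<Longrightarrow> F \<subseteq> carrier \<Gamma> \<Longrightarrow> separated W F S \<Longrightarrow>
       finite S \<and> card S \<le> itinerary_number \<alpha> \<V> F (carrier X)"
    using card_separated_le[OF W] by metis
  have "\<exists>S. finite S \<and> separated W F S \<and> itinerary_number \<alpha> \<U> F (carrier X) \<le> card S"
    if F: "finite F" "F \<subseteq> carrier \<Gamma>" for F
  proof -
    have "separated W F {}" by (simp add: separated_def)
    moreover have "\<forall>S. separated W F S \<longrightarrow> card S < Suc (itinerary_number \<alpha> \<V> F (carrier X))"
      using \<V>[OF F] by (auto simp: less_Suc_eq_le)
    ultimately obtain S where S: "separated W F S" and max: "\<And>S'. separated W F S' \<Longrightarrow> card S' \<le> card S"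
      using ex_has_greatest_nat[of "separated W F" "{}" card] by metis
    have finS: "finite S" using \<V>[OF F S] by simp
    have SX: "S \<subseteq> carrier X" using S by (simp add: separated_def)
    have "itinerary_cover \<alpha> \<U> F (carrier X) ((\<lambda>x s. u (\<alpha> s x)) ` S)"
      unfolding itinerary_cover_def
    proof (intro conjI ballI)
      fix y assume y: "y \<in> carrier X"
      have "\<exists>x\<in>S. \<forall>s\<in>F. \<alpha> s (inv x \<otimes> y) \<in> W"
      proof (cases "y \<in> S")
        case True
        then show ?thesis using y W F by (intro bexI[of _ y]) (auto simp: action_one)
      next
        case False
        then have "\<not> separated W F (insert y S)" using max[of "insert y S"] finS by auto
        then obtain x where x: "x \<in> S" "(\<forall>s\<in>F. \<alpha> s (inv x \<otimes> y) \<in> W) \<or> (\<forall>s\<in>F. \<alpha> s (inv y \<otimes> x) \<in> W)"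
          using S y by (auto simp: separated_def)
        moreover have "\<alpha> s (inv x \<otimes> y) = inv (\<alpha> s (inv y \<otimes> x))" if "s \<in> F" for s
        proof -
          have "s \<in> carrier \<Gamma>" "x \<in> carrier X" using that F x SX by auto
          then show ?thesis using y by (simp add: inv_mult_group flip: action_inv)
        qed
        ultimately show ?thesis using sym by metis
      qed
      then obtain x where x: "x \<in> S" "\<forall>s\<in>F. \<alpha> s (inv x \<otimes> y) \<in> W" by blast
      have "\<alpha> s y \<in> u (\<alpha> s x)" if s: "s \<in> F" for s
      proof -
        have G: "s \<in> carrier \<Gamma>" "x \<in> carrier X" using s F x SX by auto
        have "\<alpha> s x \<otimes> \<alpha> s (inv x \<otimes> y) = \<alpha> s (x \<otimes> (inv x \<otimes> y))"
          using G y by (simp add: action_m)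
        also have "x \<otimes> (inv x \<otimes> y) = y" using G y by (simp flip: m_assoc)
        finally show ?thesis using u[of "\<alpha> s x"] x(2) s G action_closed by metis
      qed
      then show "\<exists>w\<in>(\<lambda>x s. u (\<alpha> s x)) ` S. \<forall>s\<in>F. \<alpha> s y \<in> w s" using x(1) by auto
    next
      fix w s assume "w \<in> (\<lambda>x s. u (\<alpha> s x)) ` S" "s \<in> F"
      then obtain x where "x \<in> S" "w s = u (\<alpha> s x)" by blast
      then show "w s \<in> \<U>" using u action_closed F SX \<open>s \<in> F\<close> by (metis subsetD)
    qed (use finS in auto)
    then have "itinerary_number \<alpha> \<U> F (carrier X) \<le> card ((\<lambda>x s. u (\<alpha> s x)) ` S)"
      by (rule itinerary_number_le)
    also have "\<dots> \<le> card S" by (rule card_image_le[OF finS])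
    finally show ?thesis using S finS by blast
  qed
  then show ?thesis using that W by blast
qed

section \<open>Entropy of an open cover\<close>

definition cover_rate :: "'a set set \<Rightarrow> 'g set \<Rightarrow> real" where
  "cover_rate \<U> F = ln (real (itinerary_number \<alpha> \<U> F (carrier X))) / real (card F)"

definition cover_entropy :: "'a set set \<Rightarrow> real" where
  "cover_entropy \<U> = Lim (invariant_filter \<Gamma>) (cover_rate \<U>)"

text \<open>
  The itinerary of \<open>x\<close> along \<open>Fc\<close> is the itinerary of \<open>cx\<close> along \<open>F\<close>.
\<close>
lemma itinerary_number_translate:
  assumes \<U>: "itinerary_cover \<alpha> \<U> F D \<Omega>" and F: "F \<subseteq> carrier \<Gamma>" and c: "c \<in> carrier \<Gamma>"
    and D': "D' \<subseteq> carrier X" "\<And>x. x \<in> D' \<Longrightarrow> \<alpha> c x \<in> D"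
  shows "itinerary_number \<alpha> \<U> (F #>\<^bsub>\<Gamma>\<^esub> c) D' \<le> itinerary_number \<alpha> \<U> F D"
    and "\<exists>\<Omega>. itinerary_cover \<alpha> \<U> (F #>\<^bsub>\<Gamma>\<^esub> c) D' \<Omega>"
proof -
  obtain \<Omega> where \<Omega>: "itinerary_cover \<alpha> \<U> F D \<Omega>" "card \<Omega> = itinerary_number \<alpha> \<U> F D"
    using itinerary_number_attained[OF \<U>] .
  have cancel: "a \<otimes>\<^bsub>\<Gamma>\<^esub> c \<otimes>\<^bsub>\<Gamma>\<^esub> inv\<^bsub>\<Gamma>\<^esub> c = a" if "a \<in> F" for a
    using that F c by (auto simp: \<Gamma>.m_assoc)
  let ?\<Omega>' = "(\<lambda>w s. w (s \<otimes>\<^bsub>\<Gamma>\<^esub> inv\<^bsub>\<Gamma>\<^esub> c)) ` \<Omega>"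
  have cov: "itinerary_cover \<alpha> \<U> (F #>\<^bsub>\<Gamma>\<^esub> c) D' ?\<Omega>'"
    unfolding itinerary_cover_def
  proof (intro conjI ballI)
    fix x assume x: "x \<in> D'"
    then obtain w where w: "w \<in> \<Omega>" "\<forall>s\<in>F. \<alpha> s (\<alpha> c x) \<in> w s"
      using \<Omega>(1) D'(2) unfolding itinerary_cover_def by blast
    have "\<alpha> (a \<otimes>\<^bsub>\<Gamma>\<^esub> c) x \<in> w (a \<otimes>\<^bsub>\<Gamma>\<^esub> c \<otimes>\<^bsub>\<Gamma>\<^esub> inv\<^bsub>\<Gamma>\<^esub> c)" if a: "a \<in> F" for a
    proof -
      have "\<alpha> (a \<otimes>\<^bsub>\<Gamma>\<^esub> c) x = \<alpha> a (\<alpha> c x)" using a F c x D' by (intro action_mult) auto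
      then show ?thesis using w a cancel by simp
    qed
    then show "\<exists>w\<in>?\<Omega>'. \<forall>s\<in>F #>\<^bsub>\<Gamma>\<^esub> c. \<alpha> s x \<in> w s"
      using w(1) by (auto simp: \<Gamma>.r_coset_eq_image)
  qed (use \<Omega>(1) cancel in \<open>auto simp: itinerary_cover_def \<Gamma>.r_coset_eq_image\<close>)
  then show "\<exists>\<Omega>. itinerary_cover \<alpha> \<U> (F #>\<^bsub>\<Gamma>\<^esub> c) D' \<Omega>" by blast
  have "itinerary_number \<alpha> \<U> (F #>\<^bsub>\<Gamma>\<^esub> c) D' \<le> card ?\<Omega>'" by (rule itinerary_number_le[OF cov])
  also have "\<dots> \<le> card \<Omega>" using \<Omega>(1) by (intro card_image_le) (auto simp: itinerary_cover_def)
  finally show "itinerary_number \<alpha> \<U> (F #>\<^bsub>\<Gamma>\<^esub> c) D' \<le> itinerary_number \<alpha> \<U> F D" by (simp add: \<Omega>)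
qed

lemma ln_itinerary_number:
  assumes \<U>: "finite_open_cover T \<U>" and D: "D \<subseteq> carrier X" "D \<noteq> {}"
  shows "ln (real (itinerary_number \<alpha> \<U> {} D)) \<le> 0"
    and "finite A \<Longrightarrow> A \<subseteq> carrier \<Gamma> \<Longrightarrow> 0 \<le> ln (real (itinerary_number \<alpha> \<U> A D))"
    and "finite A \<Longrightarrow> A \<subseteq> carrier \<Gamma> \<Longrightarrow>
      ln (real (itinerary_number \<alpha> \<U> A D)) \<le> ln (real (card \<U>)) * real (card A)"
    and "finite A \<Longrightarrow> finite B \<Longrightarrow> A \<subseteq> carrier \<Gamma> \<Longrightarrow> B \<subseteq> carrier \<Gamma> \<Longrightarrow>
      ln (real (itinerary_number \<alpha> \<U> (A \<union> B) D))
        \<le> ln (real (itinerary_number \<alpha> \<U> A D)) + ln (real (itinerary_number \<alpha> \<U> B D))"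
proof -
  show "ln (real (itinerary_number \<alpha> \<U> {} D)) \<le> 0"
    using D by (simp add: itinerary_number_empty)
  have pos: "0 < itinerary_number \<alpha> \<U> A D" if "finite A" "A \<subseteq> carrier \<Gamma>" for A
    using itinerary_number_pos[OF finite_open_cover_itineraries[OF \<U> that D(1)] D(2)] .
  have "\<U> \<noteq> {}" "finite \<U>" using \<U> by (auto simp: finite_open_cover_def topspace_eq)
  then have card\<U>: "0 < card \<U>" by (simp add: card_gt_0_iff)
  {
    assume A: "finite A" "A \<subseteq> carrier \<Gamma>"
    show "0 \<le> ln (real (itinerary_number \<alpha> \<U> A D))" using pos[OF A] by simp
    have "itinerary_number \<alpha> \<U> A D \<le> card \<U> ^ card A"
      using itinerary_number_le[OF finite_open_cover_itineraries[OF \<U> A D(1)]] A by (simp add: card_PiE)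
    then have "real (itinerary_number \<alpha> \<U> A D) \<le> real (card \<U>) ^ card A"
      by (metis of_nat_le_iff of_nat_power)
    then have "ln (real (itinerary_number \<alpha> \<U> A D)) \<le> ln (real (card \<U>) ^ card A)"
      using pos[OF A] by (intro ln_mono) auto
    then show "ln (real (itinerary_number \<alpha> \<U> A D)) \<le> ln (real (card \<U>)) * real (card A)"
      using card\<U> by (simp add: ln_realpow mult.commute)
    assume B: "finite B" "B \<subseteq> carrier \<Gamma>"
    have "real (itinerary_number \<alpha> \<U> (A \<union> B) D)
        \<le> real (itinerary_number \<alpha> \<U> A D) * real (itinerary_number \<alpha> \<U> B D)"
      using itinerary_number_Un_le[OF finite_open_cover_itineraries[OF \<U> A D(1)]
          finite_open_cover_itineraries[OF \<U> B D(1)]]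
      by (metis of_nat_le_iff of_nat_mult)
    then have "ln (real (itinerary_number \<alpha> \<U> (A \<union> B) D))
        \<le> ln (real (itinerary_number \<alpha> \<U> A D) * real (itinerary_number \<alpha> \<U> B D))"
      using pos[of "A \<union> B"] A B by (intro ln_mono) auto
    then show "ln (real (itinerary_number \<alpha> \<U> (A \<union> B) D))
        \<le> ln (real (itinerary_number \<alpha> \<U> A D)) + ln (real (itinerary_number \<alpha> \<U> B D))"
      using pos[OF A] pos[OF B] by (simp add: ln_mult)
  }
qed

lemma carrier_nonempty: "carrier X \<noteq> {}" using one_closed by blast

lemma cover_entropy_limit:
  assumes \<U>: "finite_open_cover T \<U>"
  shows "(cover_rate \<U> \<longlongrightarrow> cover_entropy \<U>) (invariant_filter \<Gamma>)" and "0 \<le> cover_entropy \<U>"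
proof -
  have "\<exists>c\<ge>0. ((\<lambda>F. ln (real (itinerary_number \<alpha> \<U> F (carrier X))) / real (card F)) \<longlongrightarrow> c) (invariant_filter \<Gamma>)"
  proof (rule Ornstein_Weiss[OF amenable, where M = "ln (real (card \<U>))"])
    fix A c assume A: "finite A" "A \<subseteq> carrier \<Gamma>" and c: "c \<in> carrier \<Gamma>"
    have "itinerary_number \<alpha> \<U> (A #>\<^bsub>\<Gamma>\<^esub> c) (carrier X) \<le> itinerary_number \<alpha> \<U> A (carrier X)"
      using action_closed[OF c]
      by (intro itinerary_number_translate(1)[OF finite_open_cover_itineraries[OF \<U> A subset_refl] A(2) c]) auto
    moreover have "0 < itinerary_number \<alpha> \<U> (A #>\<^bsub>\<Gamma>\<^esub> c) (carrier X)"
      using \<Gamma>.finite_r_coset[OF A(1), of c] \<Gamma>.r_coset_subset_carrier[OF A(2) c] carrier_nonempty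
      by (intro itinerary_number_pos[OF finite_open_cover_itineraries[OF \<U>]]) auto
    ultimately show "ln (real (itinerary_number \<alpha> \<U> (A #>\<^bsub>\<Gamma>\<^esub> c) (carrier X)))
        \<le> ln (real (itinerary_number \<alpha> \<U> A (carrier X)))" by simp
  qed (use ln_itinerary_number[OF \<U> subset_refl carrier_nonempty] in auto)
  then obtain c where "0 \<le> c" "(cover_rate \<U> \<longlongrightarrow> c) (invariant_filter \<Gamma>)"
    unfolding cover_rate_def[abs_def] by blast
  moreover from this have "cover_entropy \<U> = c"
    unfolding cover_entropy_def by (intro tendsto_Lim invariant_filter_nontrivial amenable)
  ultimately show "(cover_rate \<U> \<longlongrightarrow> cover_entropy \<U>) (invariant_filter \<Gamma>)" "0 \<le> cover_entropy \<U>"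
    by auto
qed

lemma topological_entropy_eq:
  "topological_entropy \<Gamma> T \<alpha> = (SUP \<U> \<in> {\<U>. finite_open_cover T \<U>}. ereal (cover_entropy \<U>))"
  unfolding topological_entropy_def
proof (rule SUP_cong[OF refl], rule arg_cong[where f = ereal])
  fix \<U> assume "\<U> \<in> {\<U>. finite_open_cover T \<U>}"
  then have \<U>: "finite_open_cover T \<U>" by simp
  then have sub: "\<And>U. U \<in> \<U> \<Longrightarrow> U \<subseteq> topspace T" by (auto simp: finite_open_cover_def)
  have "\<forall>\<^sub>F F in invariant_filter \<Gamma>. cover_rate \<U> F =
     ln (real (min_subcover_card T (join_covers F (\<lambda>s. preimage_cover T (\<alpha> s) \<U>)))) / real (card F)"
    using \<Gamma>.eventually_invariant_filter_fin_subsets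
  proof eventually_elim
    case (elim F)
    then have "min_subcover_card T (join_covers F (\<lambda>s. preimage_cover T (\<alpha> s) \<U>)) =
         itinerary_number \<alpha> \<U> F (topspace T)"
      using action_closed
      by (intro min_subcover_card_join_covers sub) (auto simp: fin_subsets_def topspace_eq)
    then show ?case by (simp add: cover_rate_def topspace_eq)
  qed
  then show "invariant_lim \<Gamma> (\<lambda>F.
          ln (real (min_subcover_card T (join_covers F (\<lambda>s. preimage_cover T (\<alpha> s) \<U>))))
            / real (card F)) = cover_entropy \<U>"
    by (intro invariant_lim_eq[OF amenable] Lim_transform_eventually[OF cover_entropy_limit(1)[OF \<U>]])
qed

end

section \<open>Subgroups and quotients\<close>

locale closed_invariant_subgroup =
  topological_group X T + normal Y X
  for \<Gamma> :: "('g, 'm) monoid_scheme" and X :: "('a, 'n) monoid_scheme" (structure) and T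
    and \<alpha> :: "'g \<Rightarrow> 'a \<Rightarrow> 'a" and Y +
  assumes amenable: "amenable_group \<Gamma>"
    and compact: "compact_space T"
    and action: "continuous_automorphism_action \<Gamma> X T \<alpha>"
    and closed: "closedin T Y"
    and invariant: "s \<in> carrier \<Gamma> \<Longrightarrow> y \<in> Y \<Longrightarrow> \<alpha> s y \<in> Y"
begin

lemma subgroup_Y: "subgroup Y X" by (rule subgroup_axioms)

lemma action_auto: "s \<in> carrier \<Gamma> \<Longrightarrow> \<alpha> s \<in> auto X"
  using action by (auto simp: continuous_automorphism_action_def hom_def AutoGroup_def)

sublocale compact_group_action \<Gamma> X T \<alpha>
proof
  show "amenable_group \<Gamma>" by (rule amenable)
  show "compact_space T" by (rule compact)
  show "\<alpha> s \<in> hom X X" if "s \<in> carrier \<Gamma>" for s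
    using action_auto[OF that] by (simp add: auto_def)
  show "continuous_map T T (\<alpha> s)" if "s \<in> carrier \<Gamma>" for s
  proof -
    have "continuous_map T (prod_topology (discrete_topology (carrier \<Gamma>)) T) (\<lambda>x. (s, x))"
      using that by (intro continuous_map_pairedI) auto
    from continuous_map_compose[OF this, of T "\<lambda>(s, x). \<alpha> s x"] action show ?thesis
      by (simp add: o_def continuous_automorphism_action_def)
  qed
  show "\<alpha> (s \<otimes>\<^bsub>\<Gamma>\<^esub> t) x = \<alpha> s (\<alpha> t x)"
    if st: "s \<in> carrier \<Gamma>" "t \<in> carrier \<Gamma>" and x: "x \<in> carrier X" for s t x
  proof -
    have "\<alpha> (s \<otimes>\<^bsub>\<Gamma>\<^esub> t) = \<alpha> s \<otimes>\<^bsub>AutoGroup X\<^esub> \<alpha> t"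
      using action st by (intro hom_mult) (auto simp: continuous_automorphism_action_def)
    also have "\<dots> = compose (carrier X) (\<alpha> s) (\<alpha> t)"
      using action_auto st by (simp add: AutoGroup_def BijGroup_def auto_def)
    finally show ?thesis using x by (simp add: compose_def)
  qed
qed

lemma topological_group_subgroup: "topological_group (X\<lparr>carrier := Y\<rparr>) (subtopology T Y)"
proof -
  interpret Y: group "X\<lparr>carrier := Y\<rparr>" by (rule subgroup_is_group[OF group_axioms])
  show ?thesis
  proof unfold_locales
    show "topspace (subtopology T Y) = carrier (X\<lparr>carrier := Y\<rparr>)"
      using subset by (auto simp: topspace_eq)
    have "continuous_map (prod_topology (subtopology T Y) (subtopology T Y)) (subtopology T Y) (\<lambda>(x, y). x \<otimes> y)"
      unfolding subtopology_Times[symmetric]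
      by (intro continuous_map_into_subtopology continuous_map_from_subtopology continuous_mult) auto
    then show "continuous_map (prod_topology (subtopology T Y) (subtopology T Y)) (subtopology T Y)
        (\<lambda>(x, y). x \<otimes>\<^bsub>X\<lparr>carrier := Y\<rparr>\<^esub> y)"
      by simp
    have "continuous_map (subtopology T Y) (subtopology T Y) (\<lambda>x. inv x)"
      by (intro continuous_map_into_subtopology continuous_map_from_subtopology continuous_inv) auto
    then show "continuous_map (subtopology T Y) (subtopology T Y) (\<lambda>x. inv\<^bsub>X\<lparr>carrier := Y\<rparr>\<^esub> x)"
      by (rule continuous_map_eq) (auto simp: m_inv_consistent[OF subgroup_Y])
  qed
qed

sublocale sub: compact_group_action \<Gamma> "X\<lparr>carrier := Y\<rparr>" "subtopology T Y" "sub_action Y \<alpha>"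
proof -
  interpret topological_group "X\<lparr>carrier := Y\<rparr>" "subtopology T Y" by (rule topological_group_subgroup)
  show "compact_group_action \<Gamma> (X\<lparr>carrier := Y\<rparr>) (subtopology T Y) (sub_action Y \<alpha>)"
  proof unfold_locales
    show "amenable_group \<Gamma>" by (rule amenable)
    show "compact_space (subtopology T Y)"
      using closedin_compact_space[OF compact closed] by (rule compact_space_subtopology)
    show "sub_action Y \<alpha> s \<in> hom (X\<lparr>carrier := Y\<rparr>) (X\<lparr>carrier := Y\<rparr>)" if "s \<in> carrier \<Gamma>" for s
      using that subset invariant action_m by (auto simp: hom_def sub_action_def subset_iff)
    show "continuous_map (subtopology T Y) (subtopology T Y) (sub_action Y \<alpha> s)" if "s \<in> carrier \<Gamma>" for s
    proof (rule continuous_map_eq)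
      show "continuous_map (subtopology T Y) (subtopology T Y) (\<alpha> s)"
        using that invariant
        by (intro continuous_map_into_subtopology continuous_map_from_subtopology action_continuous) auto
    qed (simp add: sub_action_def)
    show "sub_action Y \<alpha> (s \<otimes>\<^bsub>\<Gamma>\<^esub> t) x = sub_action Y \<alpha> s (sub_action Y \<alpha> t x)"
      if "s \<in> carrier \<Gamma>" "t \<in> carrier \<Gamma>" "x \<in> carrier (X\<lparr>carrier := Y\<rparr>)" for s t x
      using that subset invariant action_mult by (auto simp: sub_action_def)
  qed
qed

abbreviation Q :: "'a set monoid" where "Q \<equiv> X Mod Y"
abbreviation TQ :: "'a set topology" where "TQ \<equiv> quotient_group_topology X T Y"
abbreviation coset :: "'a \<Rightarrow> 'a set" where "coset x \<equiv> Y #> x"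

lemma coset_closed: "x \<in> carrier X \<Longrightarrow> coset x \<in> carrier Q"
  by (auto simp: carrier_FactGroup)

lemma coset_surj: "q \<in> carrier Q \<Longrightarrow> \<exists>x\<in>carrier X. q = coset x"
  by (auto simp: carrier_FactGroup)

lemma coset_mult: "x \<in> carrier X \<Longrightarrow> y \<in> carrier X \<Longrightarrow> coset x \<otimes>\<^bsub>Q\<^esub> coset y = coset (x \<otimes> y)"
  by (simp add: rcos_sum)

lemma coset_inv: "x \<in> carrier X \<Longrightarrow> inv\<^bsub>Q\<^esub> coset x = coset (inv x)"
  by (simp add: inv_FactGroup coset_closed rcos_inv)

lemma coset_eq_iff: "x \<in> carrier X \<Longrightarrow> y \<in> carrier X \<Longrightarrow> coset x = coset y \<longleftrightarrow> (\<exists>h\<in>Y. x = h \<otimes> y)"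
proof
  assume xy: "x \<in> carrier X" "y \<in> carrier X"
  show "coset x = coset y \<Longrightarrow> \<exists>h\<in>Y. x = h \<otimes> y"
    using rcos_self[OF xy(1) subgroup_Y] by (auto simp: r_coset_def)
  assume "\<exists>h\<in>Y. x = h \<otimes> y"
  then obtain h where "h \<in> Y" "x = h \<otimes> y" by blast
  then show "coset x = coset y"
    using xy coset_mult_assoc[OF subset, of h y] by (simp add: rcos_const)
qed

lemma coset_action: "s \<in> carrier \<Gamma> \<Longrightarrow> x \<in> carrier X \<Longrightarrow> quotient_action X Y \<alpha> s (coset x) = coset (\<alpha> s x)"
  using invariant by (intro quotient_action_coset[OF \<Gamma>.is_group is_group action subgroup_Y]) auto

lemma quotient_map_coset: "quotient_map T TQ coset"
  by (rule quotient_map_quotient_group_topology)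

lemma topspace_TQ: "topspace TQ = carrier Q"
  using quotient_imp_surjective_map[OF quotient_map_coset] by (simp add: topspace_eq carrier_FactGroup)

lemma openin_coset_preimage: "openin TQ C \<Longrightarrow> openin T {x \<in> carrier X. coset x \<in> C}"
  by (simp add: openin_quotient_group_topology topspace_eq)

text \<open>
  The quotient map is open: the saturation of \<open>U\<close> is the union of its translates by \<open>Y\<close>.
\<close>
lemma openin_coset_image:
  assumes "openin T U" shows "openin TQ (coset ` U)"
proof -
  have U: "U \<subseteq> carrier X" by (rule openin_subset_carrier[OF assms])
  have "{x \<in> topspace T. coset x \<in> coset ` U} = (\<Union>y\<in>Y. {x \<in> topspace T. y \<otimes> x \<in> U})"
  proof (intro equalityI subsetI)
    fix x assume "x \<in> {x \<in> topspace T. coset x \<in> coset ` U}"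
    then obtain u where x: "x \<in> carrier X" and "u \<in> U" "coset u = coset x" by (auto simp: topspace_eq)
    then show "x \<in> (\<Union>y\<in>Y. {x \<in> topspace T. y \<otimes> x \<in> U})"
      using coset_eq_iff[of u x] U by (auto simp: topspace_eq)
  next
    fix x assume "x \<in> (\<Union>y\<in>Y. {x \<in> topspace T. y \<otimes> x \<in> U})"
    then obtain y where "y \<in> Y" "x \<in> carrier X" "y \<otimes> x \<in> U" by (auto simp: topspace_eq)
    moreover from this have "coset (y \<otimes> x) = coset x"
      using U by (subst coset_eq_iff) auto
    ultimately show "x \<in> {x \<in> topspace T. coset x \<in> coset ` U}"
      by (auto simp: topspace_eq)
  qed
  moreover have "openin T (\<Union>y\<in>Y. {x \<in> topspace T. y \<otimes> x \<in> U})"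
    using openin_continuous_map_preimage[OF continuous_left_translation[OF mem_carrier] assms]
    by (intro openin_Union) auto
  ultimately show ?thesis
    using U coset_closed by (auto simp: openin_quotient_group_topology)
qed

lemma topological_group_quotient: "topological_group Q TQ"
proof -
  interpret Q: group Q by (rule factorgroup_is_group)
  show ?thesis
  proof unfold_locales
    show "topspace TQ = carrier Q" by (rule topspace_TQ)
    show "continuous_map (prod_topology TQ TQ) TQ (\<lambda>(x, y). x \<otimes>\<^bsub>Q\<^esub> y)"
      unfolding continuous_map_def
    proof (intro conjI allI impI)
      show "(\<lambda>(x, y). x \<otimes>\<^bsub>Q\<^esub> y) \<in> topspace (prod_topology TQ TQ) \<rightarrow> topspace TQ"
        using Q.m_closed by (auto simp: topspace_TQ simp del: mult_FactGroup)
      fix U assume U: "openin TQ U"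
      show "openin (prod_topology TQ TQ) {p \<in> topspace (prod_topology TQ TQ). (case p of (x, y) \<Rightarrow> x \<otimes>\<^bsub>Q\<^esub> y) \<in> U}"
        unfolding openin_prod_topology_alt
      proof (intro allI impI)
        fix p q assume "(p, q) \<in> {p \<in> topspace (prod_topology TQ TQ). (case p of (x, y) \<Rightarrow> x \<otimes>\<^bsub>Q\<^esub> y) \<in> U}"
        then have pq: "p \<in> carrier Q" "q \<in> carrier Q" "p \<otimes>\<^bsub>Q\<^esub> q \<in> U"
          by (auto simp: topspace_TQ simp del: mult_FactGroup)
        then obtain x y where xy: "x \<in> carrier X" "y \<in> carrier X" "p = coset x" "q = coset y"
          using coset_surj by metis
        then have "coset (x \<otimes> y) \<in> U" using pq coset_mult by metis
        then have "x \<otimes> y \<in> {x \<in> carrier X. coset x \<in> U}" using xy by simp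
        then obtain A B where AB: "openin T A" "openin T B" "x \<in> A" "y \<in> B"
          "\<And>a b. a \<in> A \<Longrightarrow> b \<in> B \<Longrightarrow> a \<otimes> b \<in> {x \<in> carrier X. coset x \<in> U}"
          using openin_nbhd_product[OF openin_coset_preimage[OF U] xy(1,2)] by blast
        have "coset ` A \<times> coset ` B \<subseteq> {p \<in> topspace (prod_topology TQ TQ). (case p of (x, y) \<Rightarrow> x \<otimes>\<^bsub>Q\<^esub> y) \<in> U}"
        proof
          fix r assume "r \<in> coset ` A \<times> coset ` B"
          then obtain a b where ab: "a \<in> A" "b \<in> B" "r = (coset a, coset b)" by auto
          then have "a \<in> carrier X" "b \<in> carrier X" using AB openin_subset_carrier by blast+
          then show "r \<in> {p \<in> topspace (prod_topology TQ TQ). (case p of (x, y) \<Rightarrow> x \<otimes>\<^bsub>Q\<^esub> y) \<in> U}"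
            using AB(5)[OF ab(1,2)] by (simp add: ab topspace_TQ coset_closed coset_mult del: mult_FactGroup)
        qed
        then show "\<exists>U' V'. openin TQ U' \<and> openin TQ V' \<and> p \<in> U' \<and> q \<in> V' \<and>
            U' \<times> V' \<subseteq> {p \<in> topspace (prod_topology TQ TQ). (case p of (x, y) \<Rightarrow> x \<otimes>\<^bsub>Q\<^esub> y) \<in> U}"
          using AB xy openin_coset_image by (intro exI[of _ "coset ` A"] exI[of _ "coset ` B"]) auto
      qed
    qed
    have "continuous_map T TQ (coset \<circ> (\<lambda>x. inv x))"
      by (rule continuous_map_compose[OF continuous_inv quotient_imp_continuous_map[OF quotient_map_coset]])
    then have "continuous_map T TQ ((\<lambda>q. inv\<^bsub>Q\<^esub> q) \<circ> coset)"
      by (rule continuous_map_eq) (simp add: coset_inv topspace_eq)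
    then show "continuous_map TQ TQ (\<lambda>q. inv\<^bsub>Q\<^esub> q)"
      by (rule continuous_compose_quotient_map[OF quotient_map_coset])
  qed
qed

sublocale quot: compact_group_action \<Gamma> Q TQ "quotient_action X Y \<alpha>"
proof -
  interpret Q: topological_group Q TQ by (rule topological_group_quotient)
  show "compact_group_action \<Gamma> Q TQ (quotient_action X Y \<alpha>)"
  proof unfold_locales
    show "amenable_group \<Gamma>" by (rule amenable)
    have "compactin TQ (coset ` topspace T)"
      using compact quotient_imp_continuous_map[OF quotient_map_coset]
      by (intro image_compactin) (auto simp: compact_space_def)
    then show "compact_space TQ"
      by (simp add: compact_space_def quotient_imp_surjective_map[OF quotient_map_coset])
    show "quotient_action X Y \<alpha> s \<in> hom Q Q" if s: "s \<in> carrier \<Gamma>" for s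
    proof (rule homI)
      fix p assume "p \<in> carrier Q"
      then obtain x where x: "x \<in> carrier X" "p = coset x" using coset_surj by blast
      then show "quotient_action X Y \<alpha> s p \<in> carrier Q"
        using s by (simp add: coset_action coset_closed action_closed)
      fix q assume "q \<in> carrier Q"
      then obtain y where y: "y \<in> carrier X" "q = coset y" using coset_surj by blast
      show "quotient_action X Y \<alpha> s (p \<otimes>\<^bsub>Q\<^esub> q) = quotient_action X Y \<alpha> s p \<otimes>\<^bsub>Q\<^esub> quotient_action X Y \<alpha> s q"
        using s x y by (simp add: coset_mult coset_action action_m action_closed del: mult_FactGroup)
    qed
    show "continuous_map TQ TQ (quotient_action X Y \<alpha> s)" if s: "s \<in> carrier \<Gamma>" for s
    proof -
      have "continuous_map T TQ (coset \<circ> \<alpha> s)"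
        by (rule continuous_map_compose[OF action_continuous[OF s] quotient_imp_continuous_map[OF quotient_map_coset]])
      then have "continuous_map T TQ (quotient_action X Y \<alpha> s \<circ> coset)"
        by (rule continuous_map_eq) (simp add: coset_action s topspace_eq)
      then show ?thesis by (rule continuous_compose_quotient_map[OF quotient_map_coset])
    qed
    show "quotient_action X Y \<alpha> (s \<otimes>\<^bsub>\<Gamma>\<^esub> t) q = quotient_action X Y \<alpha> s (quotient_action X Y \<alpha> t q)"
      if st: "s \<in> carrier \<Gamma>" "t \<in> carrier \<Gamma>" and q: "q \<in> carrier Q" for s t q
    proof -
      obtain x where "x \<in> carrier X" "q = coset x" using coset_surj[OF q] by blast
      then show ?thesis using st by (simp add: coset_action action_closed action_mult)
    qed
  qed
qed

section \<open>Superadditivity of entropy\<close>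

text \<open>
  Choose a representative \<open>r q\<close> of every coset \<open>q\<close>. If \<open>r q \<otimes> y\<close> and \<open>r q' \<otimes> y'\<close> are close along \<open>F\<close>, then so are their
  images \<open>q\<close> and \<open>q'\<close>; if these belong to a separated set, they are equal. Then the quotient of the two
  products is the quotient of \<open>y\<close> and \<open>y'\<close>, and a separated set containing both forces \<open>y = y'\<close>. So
  separated sets of \<open>Y\<close> and of the quotient multiply to separated sets of \<open>X\<close>.
\<close>
lemma cover_entropy_superadditive:
  assumes \<V>: "finite_open_cover (subtopology T Y) \<V>" and \<Z>: "finite_open_cover TQ \<Z>"
  obtains \<U> where "finite_open_cover T \<U>"
    "sub.cover_entropy \<V> + quot.cover_entropy \<Z> \<le> cover_entropy \<U>"
proof -
  obtain WY where WY: "openin (subtopology T Y) WY" "\<one> \<in> WY"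
    and sepY: "\<And>F. finite F \<Longrightarrow> F \<subseteq> carrier \<Gamma> \<Longrightarrow>
       \<exists>S. finite S \<and> sub.separated WY F S \<and> itinerary_number (sub_action Y \<alpha>) \<V> F Y \<le> card S"
    using sub.itinerary_number_le_card_separated[OF \<V>] by auto
  obtain WQ where WQ: "openin TQ WQ" "\<one>\<^bsub>Q\<^esub> \<in> WQ"
    and sepQ: "\<And>F. finite F \<Longrightarrow> F \<subseteq> carrier \<Gamma> \<Longrightarrow>
       \<exists>S. finite S \<and> quot.separated WQ F S \<and> itinerary_number (quotient_action X Y \<alpha>) \<Z> F (carrier Q) \<le> card S"
    using quot.itinerary_number_le_card_separated[OF \<Z>] by metis
  obtain W1 where W1: "openin T W1" "WY = W1 \<inter> Y" using WY(1) by (auto simp: openin_subtopology)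
  define W where "W = W1 \<inter> {x \<in> carrier X. coset x \<in> WQ}"
  have "openin T W" unfolding W_def by (intro openin_Int W1 openin_coset_preimage WQ)
  moreover have "\<one> \<in> W" using WY WQ W1 by (auto simp: W_def coset_mult_one[OF subset])
  ultimately obtain \<U> where \<U>: "finite_open_cover T \<U>"
    and sepU: "\<And>F S. finite F \<Longrightarrow> F \<subseteq> carrier \<Gamma> \<Longrightarrow> separated W F S \<Longrightarrow>
       finite S \<and> card S \<le> itinerary_number \<alpha> \<U> F (carrier X)"
    using card_separated_le by metis
  obtain r where r: "\<And>q. q \<in> carrier Q \<Longrightarrow> r q \<in> carrier X \<and> q = coset (r q)"
    using coset_surj by metis
  have le: "itinerary_number (sub_action Y \<alpha>) \<V> F Y * itinerary_number (quotient_action X Y \<alpha>) \<Z> F (carrier Q)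
      \<le> itinerary_number \<alpha> \<U> F (carrier X)"
    if F: "finite F" "F \<subseteq> carrier \<Gamma>" for F
  proof -
    obtain SY where SY: "finite SY" "sub.separated WY F SY"
      "itinerary_number (sub_action Y \<alpha>) \<V> F Y \<le> card SY" using sepY[OF F] by blast
    obtain SQ where SQ: "finite SQ" "quot.separated WQ F SQ"
      "itinerary_number (quotient_action X Y \<alpha>) \<Z> F (carrier Q) \<le> card SQ" using sepQ[OF F] by blast
    have SYY: "SY \<subseteq> Y" using SY(2) by (auto simp: sub.separated_def)
    have SQQ: "SQ \<subseteq> carrier Q" using SQ(2) by (auto simp: quot.separated_def)
    define g where "g = (\<lambda>(q, y). r q \<otimes> y)"
    have coset_g: "coset (r q \<otimes> y) = q" if "q \<in> SQ" "y \<in> SY" for q y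
    proof -
      have "q \<in> carrier Q" "y \<in> Y" using that SQQ SYY by auto
      then have "coset (r q \<otimes> y) = q \<otimes>\<^bsub>Q\<^esub> coset y"
        using r[of q] coset_mult[of "r q" y] by auto
      also have "coset y = \<one>\<^bsub>Q\<^esub>" using \<open>y \<in> Y\<close> by (simp add: rcos_const)
      finally show ?thesis using \<open>q \<in> carrier Q\<close> quot.r_one by simp
    qed
    have key: "q = q' \<and> y = y'"
      if qy: "q \<in> SQ" "y \<in> SY" "q' \<in> SQ" "y' \<in> SY"
        and small: "\<forall>s\<in>F. \<alpha> s (inv (r q \<otimes> y) \<otimes> (r q' \<otimes> y')) \<in> W" for q y q' y'
    proof -
      have rG: "r q \<in> carrier X" "r q' \<in> carrier X" "y \<in> Y" "y' \<in> Y" "q \<in> carrier Q" "q' \<in> carrier Q"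
        using r qy SQQ SYY by auto
      then have G: "y \<in> carrier X" "y' \<in> carrier X" by auto
      have "quotient_action X Y \<alpha> s (inv\<^bsub>Q\<^esub> q \<otimes>\<^bsub>Q\<^esub> q') \<in> WQ" if s: "s \<in> F" for s
      proof -
        have "inv\<^bsub>Q\<^esub> q \<otimes>\<^bsub>Q\<^esub> q' = inv\<^bsub>Q\<^esub> (coset (r q \<otimes> y)) \<otimes>\<^bsub>Q\<^esub> coset (r q' \<otimes> y')"
          by (simp only: coset_g qy)
        also have "\<dots> = coset (inv (r q \<otimes> y) \<otimes> (r q' \<otimes> y'))"
          using rG G by (simp add: coset_inv coset_mult del: mult_FactGroup)
        finally have "quotient_action X Y \<alpha> s (inv\<^bsub>Q\<^esub> q \<otimes>\<^bsub>Q\<^esub> q') = coset (\<alpha> s (inv (r q \<otimes> y) \<otimes> (r q' \<otimes> y')))"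
          using rG G s F coset_action[of s "inv (r q \<otimes> y) \<otimes> (r q' \<otimes> y')"] by auto
        then show ?thesis using small s by (auto simp: W_def)
      qed
      then have eq: "q = q'" using SQ(2) qy by (auto simp: quot.separated_def simp del: mult_FactGroup)
      have "inv (r q \<otimes> y) \<otimes> (r q' \<otimes> y') = inv y \<otimes> (inv (r q) \<otimes> (r q \<otimes> y'))"
        using rG G eq by (simp add: inv_mult_group m_assoc)
      also have "inv (r q) \<otimes> (r q \<otimes> y') = y'" using rG G by (simp flip: m_assoc)
      finally have "inv (r q \<otimes> y) \<otimes> (r q' \<otimes> y') = inv y \<otimes> y'" .
      then have "sub_action Y \<alpha> s (inv\<^bsub>X\<lparr>carrier := Y\<rparr>\<^esub> y \<otimes>\<^bsub>X\<lparr>carrier := Y\<rparr>\<^esub> y') \<in> WY" if s: "s \<in> F" for s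
        using small s rG F invariant by (auto simp: W_def W1 sub_action_def m_inv_consistent[OF subgroup_Y])
      then have "y = y'" using SY(2) qy by (simp add: sub.separated_def)
      then show ?thesis using eq by simp
    qed
    have "inj_on g (SQ \<times> SY)"
    proof (rule inj_onI)
      fix p p' assume p: "p \<in> SQ \<times> SY" "p' \<in> SQ \<times> SY" "g p = g p'"
      obtain q y q' y' where p': "p = (q, y)" "p' = (q', y')" by fastforce
      have "r q \<otimes> y \<in> carrier X" using p p' r SQQ SYY subset by blast
      then have "inv (r q \<otimes> y) \<otimes> (r q' \<otimes> y') = \<one>" using p p' by (simp add: g_def)
      then have "\<forall>s\<in>F. \<alpha> s (inv (r q \<otimes> y) \<otimes> (r q' \<otimes> y')) \<in> W"
        using F \<open>\<one> \<in> W\<close> by (auto simp: action_one)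
      moreover have "q \<in> SQ" "y \<in> SY" "q' \<in> SQ" "y' \<in> SY" using p p' by auto
      ultimately show "p = p'" using key p' by metis
    qed
    then have card_g: "card (g ` (SQ \<times> SY)) = card SQ * card SY"
      by (simp add: card_image card_cartesian_product)
    have gX: "g ` (SQ \<times> SY) \<subseteq> carrier X" using r SQQ SYY subset by (auto simp: g_def subset_iff)
    have "separated W F (g ` (SQ \<times> SY))"
      unfolding separated_def
    proof (intro conjI ballI impI)
      fix a b assume "a \<in> g ` (SQ \<times> SY)" "b \<in> g ` (SQ \<times> SY)" and ab: "\<forall>s\<in>F. \<alpha> s (inv a \<otimes> b) \<in> W"
      then obtain q y q' y' where "q \<in> SQ" "y \<in> SY" "q' \<in> SQ" "y' \<in> SY" "a = r q \<otimes> y" "b = r q' \<otimes> y'"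
        by (auto simp: g_def)
      then show "a = b" using key[of q y q' y'] ab by simp
    qed (rule gX)
    then have "card SQ * card SY \<le> itinerary_number \<alpha> \<U> F (carrier X)"
      using sepU[OF F] card_g by metis
    moreover have "itinerary_number (sub_action Y \<alpha>) \<V> F Y * itinerary_number (quotient_action X Y \<alpha>) \<Z> F (carrier Q)
        \<le> card SY * card SQ" using SY(3) SQ(3) by (rule mult_le_mono)
    ultimately show ?thesis by (simp add: mult.commute)
  qed
  have "\<forall>\<^sub>F F in invariant_filter \<Gamma>. sub.cover_rate \<V> F + quot.cover_rate \<Z> F \<le> cover_rate \<U> F"
    using \<Gamma>.eventually_invariant_filter_fin_subsets
  proof eventually_elim
    case (elim F)
    then have F: "finite F" "F \<subseteq> carrier \<Gamma>" by (auto simp: fin_subsets_def)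
    define nY nQ where "nY = itinerary_number (sub_action Y \<alpha>) \<V> F Y"
      and "nQ = itinerary_number (quotient_action X Y \<alpha>) \<Z> F (carrier Q)"
    have "0 < nY"
      using itinerary_number_pos[OF sub.finite_open_cover_itineraries[OF \<V> F subset_refl] sub.carrier_nonempty]
      by (simp add: nY_def)
    moreover have "0 < nQ"
      using itinerary_number_pos[OF quot.finite_open_cover_itineraries[OF \<Z> F subset_refl] quot.carrier_nonempty]
      by (simp add: nQ_def)
    moreover have "real nY * real nQ \<le> real (itinerary_number \<alpha> \<U> F (carrier X))"
      using le[OF F] by (simp add: nY_def nQ_def flip: of_nat_mult)
    ultimately have "ln (real nY) + ln (real nQ) \<le> ln (real (itinerary_number \<alpha> \<U> F (carrier X)))"
      by (subst ln_mult_pos[symmetric]) (auto intro!: ln_mono)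
    then show ?case
      by (simp add: sub.cover_rate_def quot.cover_rate_def cover_rate_def nY_def nQ_def divide_right_mono
          flip: add_divide_distrib)
  qed
  then have "sub.cover_entropy \<V> + quot.cover_entropy \<Z> \<le> cover_entropy \<U>"
    by (rule tendsto_le[OF invariant_filter_nontrivial[OF amenable] cover_entropy_limit(1)[OF \<U>]
        tendsto_add[OF sub.cover_entropy_limit(1)[OF \<V>] quot.cover_entropy_limit(1)[OF \<Z>]]])
  then show ?thesis using that \<U> by blast
qed

section \<open>Subadditivity of entropy\<close>

text \<open>
  Every neighbourhood of the compact set \<open>Y\<close> contains \<open>YN\<close> for some neighbourhood \<open>N\<close> of the identity.
\<close>
lemma coset_tube:
  assumes U: "openin T U" "Y \<subseteq> U"
  obtains Z where "openin TQ Z" "\<one>\<^bsub>Q\<^esub> \<in> Z" "\<And>x. x \<in> carrier X \<Longrightarrow> coset x \<in> Z \<Longrightarrow> x \<in> U"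
proof -
  have cpt: "compact_space (subtopology T Y)" by (rule sub.compact)
  have "\<exists>A B. openin T A \<and> openin T B \<and> y \<in> A \<and> \<one> \<in> B \<and> (\<forall>a\<in>A. \<forall>b\<in>B. a \<otimes> b \<in> U)" if "y \<in> Y" for y
  proof -
    have y: "y \<in> carrier X" "\<one> \<in> carrier X" "y \<otimes> \<one> \<in> U" using that U(2) by auto
    show ?thesis by (rule openin_nbhd_product[OF U(1) y]) blast
  qed
  then obtain A B where AB: "\<And>y. y \<in> Y \<Longrightarrow> openin T (A y) \<and> openin T (B y) \<and> y \<in> A y \<and> \<one> \<in> B y
      \<and> (\<forall>a\<in>A y. \<forall>b\<in>B y. a \<otimes> b \<in> U)"
    by metis
  have top: "topspace (subtopology T Y) = Y" using sub.topspace_eq by simp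
  obtain P where P: "finite P" "P \<subseteq> Y" "Y \<subseteq> (\<Union>p\<in>P. A p \<inter> Y)"
    using compact_space_pointwise_subcover[OF cpt, of "\<lambda>y. A y \<inter> Y"] AB
    unfolding top openin_subtopology by blast
  have "P \<noteq> {}" using P(3) sub.carrier_nonempty by auto
  define N where "N = (\<Inter>p\<in>P. B p)"
  have N: "openin T N" "\<one> \<in> N" unfolding N_def using P AB \<open>P \<noteq> {}\<close> by (auto intro!: openin_INT2)
  have NX: "N \<subseteq> carrier X" by (rule openin_subset_carrier[OF N(1)])
  have "x \<in> U" if x: "x \<in> carrier X" "coset x \<in> coset ` N" for x
  proof -
    obtain n where n: "n \<in> N" "coset x = coset n" using x by auto
    then obtain y where y: "y \<in> Y" "x = y \<otimes> n" using coset_eq_iff[of x n] x NX by auto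
    then obtain p where "p \<in> P" "y \<in> A p" using P by auto
    then show ?thesis using AB[of p] P n y by (auto simp: N_def)
  qed
  moreover have "\<one>\<^bsub>Q\<^esub> \<in> coset ` N" using N coset_mult_one[OF subset] by (metis image_eqI one_FactGroup)
  ultimately show ?thesis using that[of "coset ` N"] openin_coset_image[OF N(1)] by blast
qed

text \<open>
  Itineraries describing \<open>Y\<close> describe an open set containing \<open>Y\<close>, hence all cosets near \<open>Y\<close>.
\<close>
lemma itinerary_cover_extend:
  assumes \<V>: "finite_open_cover T \<V>" and F: "finite F" "F \<noteq> {}" "F \<subseteq> carrier \<Gamma>"
    and \<Omega>: "itinerary_cover (sub_action Y \<alpha>) ((\<lambda>V. V \<inter> Y) ` \<V>) F Y \<Omega>"
  obtains Z \<Omega>' where "openin TQ Z" "\<one>\<^bsub>Q\<^esub> \<in> Z"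
    "itinerary_cover \<alpha> \<V> F {x \<in> carrier X. coset x \<in> Z} \<Omega>'" "card \<Omega>' \<le> card \<Omega>"
proof -
  have "\<forall>A \<in> (\<lambda>V. V \<inter> Y) ` \<V>. \<exists>V. V \<in> \<V> \<and> A = V \<inter> Y" by blast
  from bchoice[OF this] obtain v where
    v': "\<forall>A \<in> (\<lambda>V. V \<inter> Y) ` \<V>. v A \<in> \<V> \<and> A = v A \<inter> Y" ..
  have v: "v A \<in> \<V>" "A = v A \<inter> Y" if "A \<in> (\<lambda>V. V \<inter> Y) ` \<V>" for A
    using bspec[OF v' that] by simp_all
  define \<Omega>' where "\<Omega>' = (\<lambda>w. v \<circ> w) ` \<Omega>"
  define U where "U = (\<Union>w\<in>\<Omega>'. \<Inter>s\<in>F. {x \<in> carrier X. \<alpha> s x \<in> w s})"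
  have fin: "finite \<Omega>'" using \<Omega> by (simp add: \<Omega>'_def itinerary_cover_def)
  have w\<V>: "w s \<in> \<V>" if "w \<in> \<Omega>'" "s \<in> F" for w s
    using that v \<Omega> by (auto simp: \<Omega>'_def itinerary_cover_def)
  have "openin T {x \<in> carrier X. \<alpha> s x \<in> w s}" if "w \<in> \<Omega>'" "s \<in> F" for w s
  proof -
    have "openin T (w s)" "s \<in> carrier \<Gamma>" using w\<V>[OF that] \<V> that F by (auto simp: finite_open_cover_def)
    then show ?thesis
      using openin_continuous_map_preimage[OF action_continuous] by (simp add: topspace_eq)
  qed
  then have "openin T U" unfolding U_def using F by (intro openin_Union) (auto intro!: openin_INT2)
  moreover have "Y \<subseteq> U"
  proof
    fix y assume y: "y \<in> Y"
    then obtain w where w: "w \<in> \<Omega>" "\<forall>s\<in>F. sub_action Y \<alpha> s y \<in> w s"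
      using \<Omega> unfolding itinerary_cover_def by blast
    have "\<alpha> s y \<in> v (w s)" if s: "s \<in> F" for s
    proof -
      have "w s \<in> (\<lambda>V. V \<inter> Y) ` \<V>" using \<Omega> w s by (auto simp: itinerary_cover_def)
      moreover have "\<alpha> s y \<in> w s" using w s y by (auto simp: sub_action_def)
      ultimately show ?thesis using v by blast
    qed
    then show "y \<in> U" using w y by (auto simp: U_def \<Omega>'_def)
  qed
  ultimately obtain Z where Z: "openin TQ Z" "\<one>\<^bsub>Q\<^esub> \<in> Z" "\<And>x. x \<in> carrier X \<Longrightarrow> coset x \<in> Z \<Longrightarrow> x \<in> U"
    using coset_tube by metis
  have "itinerary_cover \<alpha> \<V> F {x \<in> carrier X. coset x \<in> Z} \<Omega>'"
    unfolding itinerary_cover_def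
  proof (intro conjI ballI)
    fix x assume "x \<in> {x \<in> carrier X. coset x \<in> Z}"
    then have "x \<in> U" using Z by auto
    then show "\<exists>w\<in>\<Omega>'. \<forall>s\<in>F. \<alpha> s x \<in> w s" by (auto simp: U_def)
  qed (use fin w\<V> in auto)
  moreover have "card \<Omega>' \<le> card \<Omega>"
    unfolding \<Omega>'_def using \<Omega> by (intro card_image_le) (auto simp: itinerary_cover_def)
  ultimately show ?thesis using that Z by blast
qed

text \<open>
  All points whose images in the quotient follow one itinerary through \<open>\<Z>\<close> are of the form \<open>xd\<close>, with a
  single \<open>x\<close> and with \<open>d\<close> mapped into \<open>Z\<close> along \<open>F\<close>. If \<open>d\<close> follows the same itinerary through \<open>\<V>\<close> as a
  chosen point \<open>e\<close>, then \<open>xd\<close> is \<open>W\<close>-close to \<open>xe\<close> along \<open>F\<close>, so that its itinerary through \<open>\<U>\<close> can be read off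
  from \<open>xe\<close>.
\<close>
lemma itinerary_number_fibre_bound:
  assumes F: "finite F" "F \<subseteq> carrier \<Gamma>"
    and u: "\<And>x. x \<in> carrier X \<Longrightarrow> u x \<in> \<U> \<and> (\<forall>w\<in>W. x \<otimes> w \<in> u x)"
    and \<V>: "\<And>V a b. V \<in> \<V> \<Longrightarrow> a \<in> V \<Longrightarrow> b \<in> V \<Longrightarrow> inv a \<otimes> b \<in> W"
    and \<V>X: "\<And>V. V \<in> \<V> \<Longrightarrow> V \<subseteq> carrier X"
    and \<Z>: "\<And>C a b. C \<in> \<Z> \<Longrightarrow> a \<in> C \<Longrightarrow> b \<in> C \<Longrightarrow> inv\<^bsub>Q\<^esub> a \<otimes>\<^bsub>Q\<^esub> b \<in> Z"
    and \<Omega>Z: "itinerary_cover (quotient_action X Y \<alpha>) \<Z> F (carrier Q) \<Omega>Z"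
    and \<Omega>V: "itinerary_cover \<alpha> \<V> F {x \<in> carrier X. \<forall>s\<in>F. coset (\<alpha> s x) \<in> Z} \<Omega>V"
  shows "itinerary_number \<alpha> \<U> F (carrier X) \<le> card \<Omega>Z * card \<Omega>V"
proof -
  \<comment> \<open>Representatives of the points following an itinerary; arbitrary elements of \<open>X\<close> where there are none.\<close>
  define xz where "xz z = (SOME x. x \<in> carrier X \<and> ((\<exists>x'\<in>carrier X. \<forall>s\<in>F. coset (\<alpha> s x') \<in> z s) \<longrightarrow> (\<forall>s\<in>F. coset (\<alpha> s x) \<in> z s)))" for z
  define ev where "ev v = (SOME x. x \<in> carrier X \<and> ((\<exists>x'\<in>carrier X. \<forall>s\<in>F. \<alpha> s x' \<in> v s) \<longrightarrow> (\<forall>s\<in>F. \<alpha> s x \<in> v s)))" for v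
  have xz: "xz z \<in> carrier X \<and> ((\<exists>x'\<in>carrier X. \<forall>s\<in>F. coset (\<alpha> s x') \<in> z s) \<longrightarrow> (\<forall>s\<in>F. coset (\<alpha> s (xz z)) \<in> z s))" for z
    unfolding xz_def by (rule someI_ex) (use carrier_nonempty in blast)
  have ev: "ev v \<in> carrier X \<and> ((\<exists>x'\<in>carrier X. \<forall>s\<in>F. \<alpha> s x' \<in> v s) \<longrightarrow> (\<forall>s\<in>F. \<alpha> s (ev v) \<in> v s))" for v
    unfolding ev_def by (rule someI_ex) (use carrier_nonempty in blast)
  define \<Omega> where "\<Omega> = (\<lambda>(z, v) s. u (\<alpha> s (xz z \<otimes> ev v))) ` (\<Omega>Z \<times> \<Omega>V)"
  have fin: "finite (\<Omega>Z \<times> \<Omega>V)" using \<Omega>Z \<Omega>V by (auto simp: itinerary_cover_def)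
  have "itinerary_cover \<alpha> \<U> F (carrier X) \<Omega>"
    unfolding itinerary_cover_def
  proof (intro conjI ballI)
    show "finite \<Omega>" using fin by (simp add: \<Omega>_def)
  next
    fix w s assume "w \<in> \<Omega>" "s \<in> F"
    then obtain z v where "w s = u (\<alpha> s (xz z \<otimes> ev v))" by (auto simp: \<Omega>_def)
    moreover have "\<alpha> s (xz z \<otimes> ev v) \<in> carrier X" using \<open>s \<in> F\<close> F xz ev by (intro action_closed) auto
    ultimately show "w s \<in> \<U>" using u by simp
  next
    fix y assume y: "y \<in> carrier X"
    then obtain z where z: "z \<in> \<Omega>Z" "\<forall>s\<in>F. quotient_action X Y \<alpha> s (coset y) \<in> z s"
      using \<Omega>Z coset_closed unfolding itinerary_cover_def by blast
    then have zy: "\<forall>s\<in>F. coset (\<alpha> s y) \<in> z s" using F y coset_action by (metis subsetD)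
    define x where "x = xz z"
    have x: "x \<in> carrier X" "\<forall>s\<in>F. coset (\<alpha> s x) \<in> z s" using xz[of z] zy y by (auto simp: x_def)
    define d where "d = inv x \<otimes> y"
    have d: "d \<in> carrier X" "y = x \<otimes> d" using x y by (auto simp: d_def simp flip: m_assoc)
    have "coset (\<alpha> s d) \<in> Z" if s: "s \<in> F" for s
    proof -
      have sG: "s \<in> carrier \<Gamma>" using s F by auto
      have "coset (\<alpha> s d) = inv\<^bsub>Q\<^esub> (coset (\<alpha> s x)) \<otimes>\<^bsub>Q\<^esub> coset (\<alpha> s y)"
        using sG x(1) y by (simp add: d_def coset_inv coset_mult action_closed action_m action_inv del: mult_FactGroup)
      moreover have "z s \<in> \<Z>" using z s \<Omega>Z by (auto simp: itinerary_cover_def)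
      ultimately show ?thesis using \<Z>[of "z s" "coset (\<alpha> s x)" "coset (\<alpha> s y)"] x(2) zy s by simp
    qed
    then obtain v where v: "v \<in> \<Omega>V" "\<forall>s\<in>F. \<alpha> s d \<in> v s"
      using \<Omega>V d(1) unfolding itinerary_cover_def by blast
    define e where "e = ev v"
    have e: "e \<in> carrier X" "\<forall>s\<in>F. \<alpha> s e \<in> v s" using ev[of v] v d(1) by (auto simp: e_def)
    have "\<alpha> s y \<in> u (\<alpha> s (x \<otimes> e))" if s: "s \<in> F" for s
    proof -
      have sG: "s \<in> carrier \<Gamma>" using s F by auto
      have "v s \<in> \<V>" using v s \<Omega>V by (auto simp: itinerary_cover_def)
      then have W: "inv (\<alpha> s e) \<otimes> \<alpha> s d \<in> W" using \<V> e(2) v(2) s by blast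
      have "\<alpha> s e \<otimes> (inv (\<alpha> s e) \<otimes> \<alpha> s d) = \<alpha> s d"
        using sG e(1) d(1) by (simp add: action_closed flip: m_assoc)
      then have "\<alpha> s (x \<otimes> e) \<otimes> (inv (\<alpha> s e) \<otimes> \<alpha> s d) = \<alpha> s y"
        using sG x(1) e(1) d by (simp add: action_m action_closed m_assoc)
      then show ?thesis using u[of "\<alpha> s (x \<otimes> e)"] W sG x(1) e(1) 
        by (metis action_closed group.is_monoid group_axioms monoid.m_closed)
    qed
    then show "\<exists>w\<in>\<Omega>. \<forall>s\<in>F. \<alpha> s y \<in> w s"
      using z(1) v(1) unfolding \<Omega>_def x_def e_def by (intro bexI[of _ "\<lambda>s. u (\<alpha> s (xz z \<otimes> ev v))"]) auto
  qed
  then have "itinerary_number \<alpha> \<U> F (carrier X) \<le> card \<Omega>" by (rule itinerary_number_le)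
  also have "\<dots> \<le> card (\<Omega>Z \<times> \<Omega>V)" unfolding \<Omega>_def by (rule card_image_le[OF fin])
  finally show ?thesis by (simp add: card_cartesian_product)
qed

text \<open>
  The tiles are the sets whose itinerary count on \<open>Y\<close> is close to optimal; the term with \<open>card \<V>\<close>
  pays for the points of \<open>F\<close> outside the tiles. The error depends on \<open>e\<close> but not on the cover \<open>\<Z>\<close> of the
  quotient, which varies with \<open>e\<close>.
\<close>
lemma cover_entropy_le_error:
  assumes \<U>: "finite_open_cover T \<U>"
    and W: "\<And>x. x \<in> carrier X \<Longrightarrow> \<exists>U\<in>\<U>. \<forall>w\<in>W. x \<otimes> w \<in> U"
    and \<V>: "finite_open_cover T \<V>" "\<And>V a b. V \<in> \<V> \<Longrightarrow> a \<in> V \<Longrightarrow> b \<in> V \<Longrightarrow> inv a \<otimes> b \<in> W"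
    and hY: "sub.cover_entropy ((\<lambda>V. V \<inter> Y) ` \<V>) \<le> hY"
    and hQ: "\<And>\<Z>. finite_open_cover TQ \<Z> \<Longrightarrow> quot.cover_entropy \<Z> \<le> hQ"
    and e: "0 < e" "e \<le> 1/2"
  shows "cover_entropy \<U> \<le> hQ + ((hY + e) / (1 - e) + ln (real (card \<V>)) * e)"
proof -
  let ?\<beta> = "quotient_action X Y \<alpha>"
  let ?Fil = "invariant_filter \<Gamma>"
  let ?err = "(hY + e) / (1 - e) + ln (real (card \<V>)) * e"
  note nt = invariant_filter_nontrivial[OF amenable]
  define \<V>Y where "\<V>Y = (\<lambda>V. V \<inter> Y) ` \<V>"
  define nY where "nY A = itinerary_number (sub_action Y \<alpha>) \<V>Y A Y" for A
  obtain u where u: "\<And>x. x \<in> carrier X \<Longrightarrow> u x \<in> \<U> \<and> (\<forall>w\<in>W. x \<otimes> w \<in> u x)"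
    using W by metis
  have \<V>X: "V \<subseteq> carrier X" if "V \<in> \<V>" for V
    using \<V>(1) that openin_subset_carrier by (auto simp: finite_open_cover_def)
  have "\<Union>\<V>Y = Y" using \<V>(1) subset by (auto simp: \<V>Y_def finite_open_cover_def topspace_eq)
  then have \<V>Y: "finite_open_cover (subtopology T Y) \<V>Y"
    using \<V>(1) sub.topspace_eq by (auto simp: \<V>Y_def finite_open_cover_def openin_subtopology)
  have "\<forall>\<^sub>F F in ?Fil. sub.cover_rate \<V>Y F < hY + e"
    using order_tendstoD(2)[OF sub.cover_entropy_limit(1)[OF \<V>Y], of "hY + e"] hY e by (simp add: \<V>Y_def)
  then have fr: "\<exists>\<^sub>F F in ?Fil. sub.cover_rate \<V>Y F < hY + e"
    by (rule eventually_frequently[OF nt])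
  obtain \<T> where fin\<T>: "finite \<T>" and \<T>: "\<T> \<subseteq> {A \<in> fin_subsets \<Gamma>. sub.cover_rate \<V>Y A < hY + e}"
    and ev: "\<forall>\<^sub>F F in ?Fil. \<exists>R. quasi_tiling \<Gamma> e \<T> F R \<and>
       real (card (F - tiled_part \<Gamma> R)) \<le> e * real (card F)"
    by (rule \<Gamma>.quasi_tiling_exists[OF fr e])
  have \<T>fin: "finite A" "A \<noteq> {}" "A \<subseteq> carrier \<Gamma>" if "A \<in> \<T>" for A
    using that \<T> by (auto simp: fin_subsets_def)
  \<comment> \<open>A tile \<open>Ac \<subseteq> F\<close> need not contain \<open>c\<close>. Writing it as \<open>(Aa\<^sup>-\<^sup>1)(ac)\<close> with \<open>a \<in> A\<close> makes the translating
    element \<open>ac\<close> a member of \<open>F\<close>, where the images of the points of \<open>D\<close> are controlled.\<close>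
  have "\<forall>A\<in>\<T>. \<exists>a Z \<Omega>. a \<in> A \<and> openin TQ Z \<and> \<one>\<^bsub>Q\<^esub> \<in> Z \<and>
    itinerary_cover \<alpha> \<V> (A #>\<^bsub>\<Gamma>\<^esub> inv\<^bsub>\<Gamma>\<^esub> a) {x \<in> carrier X. coset x \<in> Z} \<Omega> \<and> card \<Omega> \<le> nY A"
  proof
    fix A assume A: "A \<in> \<T>"
    then obtain a where a: "a \<in> A" using \<T>fin by blast
    let ?A' = "A #>\<^bsub>\<Gamma>\<^esub> inv\<^bsub>\<Gamma>\<^esub> a"
    have aG: "inv\<^bsub>\<Gamma>\<^esub> a \<in> carrier \<Gamma>" using \<T>fin[OF A] a by auto
    have A': "finite ?A'" "?A' \<noteq> {}" "?A' \<subseteq> carrier \<Gamma>"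
      using \<T>fin[OF A] aG \<Gamma>.finite_r_coset \<Gamma>.r_coset_subset_carrier a
      by (auto simp: \<Gamma>.r_coset_eq_image)
    have "itinerary_cover (sub_action Y \<alpha>) \<V>Y A Y (A \<rightarrow>\<^sub>E \<V>Y)"
      using sub.finite_open_cover_itineraries[OF \<V>Y] \<T>fin[OF A] by simp
    from sub.itinerary_number_translate[OF this \<T>fin(3)[OF A] aG, of Y]
    have "nY ?A' \<le> nY A" and "\<exists>\<Omega>. itinerary_cover (sub_action Y \<alpha>) \<V>Y ?A' Y \<Omega>"
      using sub.action_closed[OF aG] by (auto simp: nY_def)
    then obtain \<Omega> where \<Omega>: "itinerary_cover (sub_action Y \<alpha>) \<V>Y ?A' Y \<Omega>" "card \<Omega> \<le> nY A"
      using itinerary_number_attained unfolding nY_def by metis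
    obtain Z \<Omega>' where "openin TQ Z" "\<one>\<^bsub>Q\<^esub> \<in> Z"
      "itinerary_cover \<alpha> \<V> ?A' {x \<in> carrier X. coset x \<in> Z} \<Omega>'" "card \<Omega>' \<le> card \<Omega>"
      using itinerary_cover_extend[OF \<V>(1) A' \<Omega>(1)[unfolded \<V>Y_def]] .
    then show "\<exists>a Z \<Omega>. a \<in> A \<and> openin TQ Z \<and> \<one>\<^bsub>Q\<^esub> \<in> Z \<and>
      itinerary_cover \<alpha> \<V> (A #>\<^bsub>\<Gamma>\<^esub> inv\<^bsub>\<Gamma>\<^esub> a) {x \<in> carrier X. coset x \<in> Z} \<Omega> \<and> card \<Omega> \<le> nY A"
      using a \<Omega>(2) by (meson order_trans)
  qed
  from bchoice[OF this] obtain a where "\<forall>A\<in>\<T>. \<exists>Z \<Omega>. a A \<in> A \<and> openin TQ Z \<and> \<one>\<^bsub>Q\<^esub> \<in> Z \<and>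
    itinerary_cover \<alpha> \<V> (A #>\<^bsub>\<Gamma>\<^esub> inv\<^bsub>\<Gamma>\<^esub> a A) {x \<in> carrier X. coset x \<in> Z} \<Omega> \<and> card \<Omega> \<le> nY A" ..
  from bchoice[OF this] obtain ZA where "\<forall>A\<in>\<T>. \<exists>\<Omega>. a A \<in> A \<and> openin TQ (ZA A) \<and> \<one>\<^bsub>Q\<^esub> \<in> ZA A \<and>
    itinerary_cover \<alpha> \<V> (A #>\<^bsub>\<Gamma>\<^esub> inv\<^bsub>\<Gamma>\<^esub> a A) {x \<in> carrier X. coset x \<in> ZA A} \<Omega> \<and> card \<Omega> \<le> nY A" ..
  from bchoice[OF this] obtain \<Omega>A where tile': "\<forall>A\<in>\<T>. a A \<in> A \<and> openin TQ (ZA A) \<and> \<one>\<^bsub>Q\<^esub> \<in> ZA A \<and>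
    itinerary_cover \<alpha> \<V> (A #>\<^bsub>\<Gamma>\<^esub> inv\<^bsub>\<Gamma>\<^esub> a A) {x \<in> carrier X. coset x \<in> ZA A} (\<Omega>A A) \<and> card (\<Omega>A A) \<le> nY A" ..
  note tile = bspec[OF tile']
  define Z where "Z = (\<Inter>A\<in>\<T>. ZA A) \<inter> topspace TQ"
  have Z: "openin TQ Z" "\<one>\<^bsub>Q\<^esub> \<in> Z"
  proof -
    show "openin TQ Z" unfolding Z_def by (rule openin_INT[OF fin\<T>]) (use tile in blast)
    show "\<one>\<^bsub>Q\<^esub> \<in> Z"
      using tile quot.one_closed by (auto simp: Z_def topspace_TQ simp del: one_FactGroup)
  qed
  obtain \<Z> where \<Z>: "finite_open_cover TQ \<Z>"
    "\<And>C p q. C \<in> \<Z> \<Longrightarrow> p \<in> C \<Longrightarrow> q \<in> C \<Longrightarrow> inv\<^bsub>Q\<^esub> p \<otimes>\<^bsub>Q\<^esub> q \<in> Z"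
    using quot.fine_cover[OF quot.compact Z] by blast
  have "\<forall>\<^sub>F F in ?Fil. cover_rate \<U> F \<le> quot.cover_rate \<Z> F + ?err"
    using ev \<Gamma>.eventually_invariant_filter_fin_subsets
  proof eventually_elim
    case (elim F)
    then obtain R where R: "quasi_tiling \<Gamma> e \<T> F R"
      "real (card (F - tiled_part \<Gamma> R)) \<le> e * real (card F)" by blast
    have F: "finite F" "F \<subseteq> carrier \<Gamma>" "card F > 0"
      using elim(2) by (auto simp: fin_subsets_def card_gt_0_iff)
    define D where "D = {x \<in> carrier X. \<forall>s\<in>F. coset (\<alpha> s x) \<in> Z}"
    have "\<one> \<in> D"
      using Z(2) F(2) by (auto simp: D_def action_one coset_mult_one[OF subset])
    then have D: "D \<subseteq> carrier X" "D \<noteq> {}" by (auto simp: D_def)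
    define \<phi> where "\<phi> A = ln (real (itinerary_number \<alpha> \<V> A D))" for A
    note ln_props = ln_itinerary_number[OF \<V>(1) D, folded \<phi>_def]
    have hY0: "0 \<le> hY" using sub.cover_entropy_limit(2)[OF \<V>Y] hY by (simp add: \<V>Y_def)
    have "card \<V> \<noteq> 0"
      using \<V>(1) carrier_nonempty by (auto simp: finite_open_cover_def topspace_eq)
    then have M: "0 \<le> ln (real (card \<V>))" by simp
    have \<phi>F: "\<phi> F \<le> ?err * real (card F)"
    proof (rule \<Gamma>.subadditive_le_quasi_tiling[where \<phi> = \<phi>, OF R F(1) _ ln_props(1)])
      fix A B assume "A \<subseteq> F" "B \<subseteq> F"
      then show "\<phi> (A \<union> B) \<le> \<phi> A + \<phi> B" using ln_props(4) F by (meson finite_subset order_trans)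
    next
      fix A assume "A \<subseteq> F"
      then show "\<phi> A \<le> ln (real (card \<V>)) * real (card A)"
        using ln_props(3) F by (meson finite_subset order_trans)
    next
      fix A c assume A: "A \<in> \<T>" and c: "c \<in> carrier \<Gamma>" and AF: "A #>\<^bsub>\<Gamma>\<^esub> c \<subseteq> F"
      note Afin = \<T>fin[OF A]
      have aA: "a A \<in> A" "a A \<in> carrier \<Gamma>" using tile[OF A] Afin by auto
      have acF: "a A \<otimes>\<^bsub>\<Gamma>\<^esub> c \<in> F" using AF aA by (auto simp: r_coset_def)
      have "(A #>\<^bsub>\<Gamma>\<^esub> inv\<^bsub>\<Gamma>\<^esub> a A) #>\<^bsub>\<Gamma>\<^esub> (a A \<otimes>\<^bsub>\<Gamma>\<^esub> c) = A #>\<^bsub>\<Gamma>\<^esub> c"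
        using Afin aA c by (simp add: \<Gamma>.coset_mult_assoc flip: \<Gamma>.m_assoc)
      moreover have "itinerary_number \<alpha> \<V> ((A #>\<^bsub>\<Gamma>\<^esub> inv\<^bsub>\<Gamma>\<^esub> a A) #>\<^bsub>\<Gamma>\<^esub> (a A \<otimes>\<^bsub>\<Gamma>\<^esub> c)) D
          \<le> itinerary_number \<alpha> \<V> (A #>\<^bsub>\<Gamma>\<^esub> inv\<^bsub>\<Gamma>\<^esub> a A) {x \<in> carrier X. coset x \<in> ZA A}"
      proof (rule itinerary_number_translate(1))
        show "itinerary_cover \<alpha> \<V> (A #>\<^bsub>\<Gamma>\<^esub> inv\<^bsub>\<Gamma>\<^esub> a A) {x \<in> carrier X. coset x \<in> ZA A} (\<Omega>A A)"
          using tile[OF A] by blast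
        show "A #>\<^bsub>\<Gamma>\<^esub> inv\<^bsub>\<Gamma>\<^esub> a A \<subseteq> carrier \<Gamma>" using Afin aA by (intro \<Gamma>.r_coset_subset_carrier) auto
        show "a A \<otimes>\<^bsub>\<Gamma>\<^esub> c \<in> carrier \<Gamma>" using aA c by auto
        show "D \<subseteq> carrier X" by (rule D)
        fix x assume "x \<in> D"
        then show "\<alpha> (a A \<otimes>\<^bsub>\<Gamma>\<^esub> c) x \<in> {x \<in> carrier X. coset x \<in> ZA A}"
          using acF A F(2) by (auto simp: D_def Z_def intro: action_closed)
      qed
      moreover have "itinerary_number \<alpha> \<V> (A #>\<^bsub>\<Gamma>\<^esub> inv\<^bsub>\<Gamma>\<^esub> a A) {x \<in> carrier X. coset x \<in> ZA A} \<le> nY A"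
        using tile[OF A] itinerary_number_le order_trans by metis
      ultimately have le: "itinerary_number \<alpha> \<V> (A #>\<^bsub>\<Gamma>\<^esub> c) D \<le> nY A" by simp
      have "finite (A #>\<^bsub>\<Gamma>\<^esub> c)" "A #>\<^bsub>\<Gamma>\<^esub> c \<subseteq> carrier \<Gamma>" using AF F finite_subset by auto
      then have "0 < itinerary_number \<alpha> \<V> (A #>\<^bsub>\<Gamma>\<^esub> c) D"
        using itinerary_number_pos[OF finite_open_cover_itineraries[OF \<V>(1) _ _ D(1)] D(2)] by blast
      then have "\<phi> (A #>\<^bsub>\<Gamma>\<^esub> c) \<le> ln (real (nY A))" using le by (simp add: \<phi>_def)
      also have "\<dots> \<le> (hY + e) * real (card A)"
      proof -
        have "sub.cover_rate \<V>Y A < hY + e" "card A > 0" using A \<T> Afin by (auto simp: card_gt_0_iff)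
        then show ?thesis by (simp add: sub.cover_rate_def nY_def field_simps)
      qed
      finally show "\<phi> (A #>\<^bsub>\<Gamma>\<^esub> c) \<le> (hY + e) * real (card A)" .
    qed (use e hY0 M in auto)
    obtain \<Omega>Z where \<Omega>Z: "itinerary_cover ?\<beta> \<Z> F (carrier Q) \<Omega>Z"
      "card \<Omega>Z = itinerary_number ?\<beta> \<Z> F (carrier Q)"
      using itinerary_number_attained[OF quot.finite_open_cover_itineraries[OF \<Z>(1) F(1,2) subset_refl]] .
    obtain \<Omega>V where \<Omega>V: "itinerary_cover \<alpha> \<V> F D \<Omega>V" "card \<Omega>V = itinerary_number \<alpha> \<V> F D"
      using itinerary_number_attained[OF finite_open_cover_itineraries[OF \<V>(1) F(1,2) D(1)]] .
    have "itinerary_number \<alpha> \<U> F (carrier X) \<le> card \<Omega>Z * card \<Omega>V"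
      by (rule itinerary_number_fibre_bound[OF F(1,2) u \<V>(2) \<V>X \<Z>(2) \<Omega>Z(1) \<Omega>V(1)[unfolded D_def]])
    then have le: "real (itinerary_number \<alpha> \<U> F (carrier X))
        \<le> real (itinerary_number ?\<beta> \<Z> F (carrier Q)) * real (itinerary_number \<alpha> \<V> F D)"
      by (simp add: \<Omega>Z \<Omega>V flip: of_nat_mult)
    have pos: "0 < itinerary_number \<alpha> \<U> F (carrier X)"
      "0 < itinerary_number ?\<beta> \<Z> F (carrier Q)" "0 < itinerary_number \<alpha> \<V> F D"
      using itinerary_number_pos[OF finite_open_cover_itineraries[OF \<U> F(1,2) subset_refl] carrier_nonempty]
        itinerary_number_pos[OF \<Omega>Z(1) quot.carrier_nonempty] itinerary_number_pos[OF \<Omega>V(1) D(2)] by auto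
    have "ln (real (itinerary_number \<alpha> \<U> F (carrier X)))
        \<le> ln (real (itinerary_number ?\<beta> \<Z> F (carrier Q)) * real (itinerary_number \<alpha> \<V> F D))"
      using le pos by (intro ln_mono) auto
    also have "\<dots> = ln (real (itinerary_number ?\<beta> \<Z> F (carrier Q))) + \<phi> F"
      using pos by (simp add: ln_mult_pos \<phi>_def)
    also have "\<dots> \<le> ln (real (itinerary_number ?\<beta> \<Z> F (carrier Q))) + ?err * real (card F)"
      using \<phi>F by simp
    finally have "ln (real (itinerary_number \<alpha> \<U> F (carrier X))) / real (card F)
        \<le> (ln (real (itinerary_number ?\<beta> \<Z> F (carrier Q))) + ?err * real (card F)) / real (card F)"
      by (rule divide_right_mono) simp
    then show ?case
      using F(3) by (simp add: cover_rate_def quot.cover_rate_def add_divide_distrib)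
  qed
  then have "cover_entropy \<U> \<le> quot.cover_entropy \<Z> + ?err"
    by (rule tendsto_le[OF nt tendsto_add[OF quot.cover_entropy_limit(1)[OF \<Z>(1)] tendsto_const]
        cover_entropy_limit(1)[OF \<U>]])
  then show ?thesis using hQ[OF \<Z>(1)] by simp
qed

lemma cover_entropy_le:
  assumes \<U>: "finite_open_cover T \<U>"
    and hY: "\<And>\<V>. finite_open_cover (subtopology T Y) \<V> \<Longrightarrow> sub.cover_entropy \<V> \<le> hY"
    and hQ: "\<And>\<Z>. finite_open_cover TQ \<Z> \<Longrightarrow> quot.cover_entropy \<Z> \<le> hQ"
  shows "cover_entropy \<U> \<le> hY + hQ"
proof (rule field_le_epsilon)
  fix \<epsilon> :: real assume "0 < \<epsilon>"
  obtain W where W: "openin T W" "\<one> \<in> W" and "\<And>w. w \<in> W \<Longrightarrow> inv w \<in> W"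
    and leb: "\<And>x. x \<in> carrier X \<Longrightarrow> \<exists>U\<in>\<U>. \<forall>w\<in>W. x \<otimes> w \<in> U"
    using Lebesgue_neighbourhood[OF compact \<U>] by blast
  obtain \<V> where \<V>: "finite_open_cover T \<V>" "\<And>V a b. V \<in> \<V> \<Longrightarrow> a \<in> V \<Longrightarrow> b \<in> V \<Longrightarrow> inv a \<otimes> b \<in> W"
    using fine_cover[OF compact W] by blast
  have "\<Union>((\<lambda>V. V \<inter> Y) ` \<V>) = Y" using \<V>(1) subset by (auto simp: finite_open_cover_def topspace_eq)
  then have "finite_open_cover (subtopology T Y) ((\<lambda>V. V \<inter> Y) ` \<V>)"
    using \<V>(1) sub.topspace_eq by (auto simp: finite_open_cover_def openin_subtopology)
  then have hY': "sub.cover_entropy ((\<lambda>V. V \<inter> Y) ` \<V>) \<le> hY" by (rule hY)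
  obtain e where e: "0 < e" "e \<le> 1/2" "(hY + e) / (1 - e) + ln (real (card \<V>)) * e < hY + \<epsilon>"
    using small_tiling_error[OF \<open>0 < \<epsilon>\<close>] by blast
  have "cover_entropy \<U> \<le> hQ + ((hY + e) / (1 - e) + ln (real (card \<V>)) * e)"
    by (rule cover_entropy_le_error[OF \<U> leb \<V> hY' hQ e(1,2)])
  then show "cover_entropy \<U> \<le> hY + hQ + \<epsilon>" using e(3) by linarith
qed

section \<open>The addition formula\<close>

theorem topological_entropy_addition:
  "topological_entropy \<Gamma> T \<alpha> =
     topological_entropy \<Gamma> (subtopology T Y) (sub_action Y \<alpha>) + topological_entropy \<Gamma> TQ (quotient_action X Y \<alpha>)"
  (is "?hX = ?hY + ?hQ")
proof (rule antisym)
  have hY: "?hY = (SUP \<V>\<in>{\<V>. finite_open_cover (subtopology T Y) \<V>}. ereal (sub.cover_entropy \<V>))"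
    by (rule sub.topological_entropy_eq)
  have hQ: "?hQ = (SUP \<Z>\<in>{\<Z>. finite_open_cover TQ \<Z>}. ereal (quot.cover_entropy \<Z>))"
    by (rule quot.topological_entropy_eq)
  have hX: "?hX = (SUP \<U>\<in>{\<U>. finite_open_cover T \<U>}. ereal (cover_entropy \<U>))"
    by (rule topological_entropy_eq)
  have leY: "ereal (sub.cover_entropy \<V>) \<le> ?hY" if "finite_open_cover (subtopology T Y) \<V>" for \<V>
    unfolding hY using that by (intro SUP_upper) auto
  have leQ: "ereal (quot.cover_entropy \<Z>) \<le> ?hQ" if "finite_open_cover TQ \<Z>" for \<Z>
    unfolding hQ using that by (intro SUP_upper) auto
  have trivY: "finite_open_cover (subtopology T Y) {topspace (subtopology T Y)}"
    and trivQ: "finite_open_cover TQ {topspace TQ}"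
    by (auto simp: finite_open_cover_def simp del: topspace_subtopology)
  have Y0: "0 \<le> ?hY" using leY[OF trivY] sub.cover_entropy_limit(2)[OF trivY] by (metis ereal_less_eq(5) order_trans)
  have Q0: "0 \<le> ?hQ" using leQ[OF trivQ] quot.cover_entropy_limit(2)[OF trivQ] by (metis ereal_less_eq(5) order_trans)
  show "?hX \<le> ?hY + ?hQ"
  proof (cases "?hY = \<infinity> \<or> ?hQ = \<infinity>")
    case True
    then show ?thesis using Y0 Q0 by auto
  next
    case False
    then obtain y q where yq: "?hY = ereal y" "?hQ = ereal q"
      using Y0 Q0 by (cases ?hY; cases ?hQ) auto
    have "cover_entropy \<U> \<le> y + q" if "finite_open_cover T \<U>" for \<U>
      using cover_entropy_le[OF that, of y q] leY leQ by (simp add: yq)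
    then show ?thesis unfolding hX by (intro SUP_least) (simp add: yq)
  qed
  have le: "ereal (sub.cover_entropy \<V>) + ereal (quot.cover_entropy \<Z>) \<le> ?hX"
    if \<V>: "finite_open_cover (subtopology T Y) \<V>" and \<Z>: "finite_open_cover TQ \<Z>" for \<V> \<Z>
  proof -
    obtain \<U> where \<U>: "finite_open_cover T \<U>"
      "sub.cover_entropy \<V> + quot.cover_entropy \<Z> \<le> cover_entropy \<U>"
      using cover_entropy_superadditive[OF \<V> \<Z>] .
    have "ereal (sub.cover_entropy \<V>) + ereal (quot.cover_entropy \<Z>) \<le> ereal (cover_entropy \<U>)"
      using \<U>(2) by simp
    also have "\<dots> \<le> ?hX" unfolding hX using \<U>(1) by (intro SUP_upper) auto
    finally show ?thesis .
  qed
  have "?hY + ereal (quot.cover_entropy \<Z>) \<le> ?hX" if \<Z>: "finite_open_cover TQ \<Z>" for \<Z>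
  proof -
    have "?hY + ereal (quot.cover_entropy \<Z>) =
        (SUP \<V>\<in>{\<V>. finite_open_cover (subtopology T Y) \<V>}. ereal (sub.cover_entropy \<V>) + ereal (quot.cover_entropy \<Z>))"
      unfolding hY using trivY by (intro SUP_ereal_add_left[symmetric]) auto
    also have "\<dots> \<le> ?hX" using le \<Z> by (intro SUP_least) auto
    finally show ?thesis .
  qed
  moreover have "?hY + ?hQ =
      (SUP \<Z>\<in>{\<Z>. finite_open_cover TQ \<Z>}. ?hY + ereal (quot.cover_entropy \<Z>))"
    unfolding hQ using trivQ Y0 by (intro SUP_ereal_add_right[symmetric]) auto
  ultimately show "?hY + ?hQ \<le> ?hX" by (auto intro: SUP_least)
qed

end

theorem corollary1p4:
  fixes \<Gamma> :: "('g, 'm) monoid_scheme"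
    and X :: "('a, 'n) monoid_scheme"
    and T :: "'a topology"
    and \<alpha> :: "'g \<Rightarrow> 'a \<Rightarrow> 'a"
    and Y :: "'a set"
  assumes "amenable_group \<Gamma>"
    and "comm_group X" "topological_group X T" "compact_space T" "Hausdorff_space T"
    and "continuous_automorphism_action \<Gamma> X T \<alpha>"
    and "subgroup Y X" "closedin T Y"
    and "\<forall>s \<in> carrier \<Gamma>. \<forall>y \<in> Y. \<alpha> s y \<in> Y"
  shows "topological_entropy \<Gamma> T \<alpha> =
           topological_entropy \<Gamma> (subtopology T Y) (sub_action Y \<alpha>) +
           topological_entropy \<Gamma> (quotient_group_topology X T Y) (quotient_action X Y \<alpha>)"
proof -
  interpret topological_group X T by fact
  interpret normal Y X by (rule comm_group.subgroup_imp_normal) fact+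
  interpret closed_invariant_subgroup \<Gamma> X T \<alpha> Y
    by unfold_locales (use assms in auto)
  show ?thesis by (rule topological_entropy_addition)
qed

end
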